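(* Let $L$ be a non-degenerate 4-bar linkage. Then: (1) There is a continuous bijection $\varphi:(0,\infty)\to \mathrm{Int}\,M^C(L)$ which maps a charge $t$ to the minimum point of $E_t$ (the point of $M(L)$ at which $E_t$ attains its minimal value on $M(L)$). (2) The mapping $\varphi$ extends to a bijection $\varphi:[0,\infty]\to M^C(L)$.
   Context: A 4-bar linkage $L=L(a,b,c,d)$ is given by positive sidelengths $a,b,c,d$. Its moduli space is $M(L)=\{(p_1,p_2,p_3,p_4)\in(\mathbb{R}^2)^4 : |p_1p_2|=a,\ |p_2p_3|=b,\ |p_3p_4|=c,\ |p_4p_1|=d\}/\mathrm{Iso}(\mathbb{R}^2)$, the quotient by all isometries of the plane (including orientation-reversing ones). $L$ is assumed to have configurations ($M(L)\neq\emptyset$). Non-degenerate means that no configuration of $L$ has all its vertices on one line; in this case $M(L)$ is a smooth closed curve homeomorphic to a circle. $M^C(L)\subset M(L)$ is the set of convex configurations, where non-strictly convex polygons (some angle equal to $\pi$) are allowed; it is homeomorphic to a segment. $\mathrm{Int}\,M^C(L)$ is the set of strictly convex configurations (all angles less than $\pi$), and the boundary $\partial M^C(L)$ consists of the convex configurations with an angle equal to $\pi$. For a configuration put $x=|p_1p_3|$ and $y=|p_2p_4|$. A controlling charge $t$ is placed at vertex $p_1$ and charges $+1$ at $p_2,p_3,p_4$; the (effective) Coulomb potential is the function $E_t:M(L)\to\mathbb{R}$, $E_t=\frac{t}{x}+\frac1y$. *)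

theory Defs
  imports "HOL-Analysis.Analysis"
begin

section \<open>Quotient topology\<close>

definition quotient_topology :: "'a topology \<Rightarrow> ('a \<times> 'a) set \<Rightarrow> 'a set topology" where
  "quotient_topology X r =
     topology (\<lambda>U. U \<subseteq> topspace X // r \<and> openin X {x \<in> topspace X. r `` {x} \<in> U})"

lemma openin_quotient_topology:
  "openin (quotient_topology X r) U \<longleftrightarrow>
     U \<subseteq> topspace X // r \<and> openin X {x \<in> topspace X. r `` {x} \<in> U}"
proof -
  have "istopology (\<lambda>U. U \<subseteq> topspace X // r \<and> openin X {x \<in> topspace X. r `` {x} \<in> U})"
    unfolding istopology_def
  proof (intro conjI allI impI)
    fix S T
    assume "S \<subseteq> topspace X // r \<and> openin X {x \<in> topspace X. r `` {x} \<in> S}"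
      and "T \<subseteq> topspace X // r \<and> openin X {x \<in> topspace X. r `` {x} \<in> T}"
    moreover have "{x \<in> topspace X. r `` {x} \<in> S \<inter> T} =
        {x \<in> topspace X. r `` {x} \<in> S} \<inter> {x \<in> topspace X. r `` {x} \<in> T}"
      by blast
    ultimately show "S \<inter> T \<subseteq> topspace X // r"
      and "openin X {x \<in> topspace X. r `` {x} \<in> S \<inter> T}"
      by auto
  next
    fix K
    assume K: "\<forall>S\<in>K. S \<subseteq> topspace X // r \<and> openin X {x \<in> topspace X. r `` {x} \<in> S}"
    then show "\<Union>K \<subseteq> topspace X // r" by blast
    have "{x \<in> topspace X. r `` {x} \<in> \<Union>K} = (\<Union>S\<in>K. {x \<in> topspace X. r `` {x} \<in> S})"
      by blast
    then show "openin X {x \<in> topspace X. r `` {x} \<in> \<Union>K}"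
      using K by auto
  qed
  then show ?thesis
    by (simp add: quotient_topology_def topology_inverse')
qed

lemma topspace_quotient_topology: "topspace (quotient_topology X r) = topspace X // r"
proof -
  have "{x \<in> topspace X. r `` {x} \<in> topspace X // r} = topspace X"
    by (auto simp: quotient_def)
  then have "openin (quotient_topology X r) (topspace X // r)"
    by (simp add: openin_quotient_topology)
  moreover have "topspace (quotient_topology X r) \<subseteq> topspace X // r"
    using openin_topspace[of "quotient_topology X r"] unfolding openin_quotient_topology by blast
  ultimately show ?thesis
    by (simp add: openin_subset subset_antisym)
qed

lemma quotient_map_quotient_topology:
  "quotient_map X (quotient_topology X r) (\<lambda>x. r `` {x})"
  unfolding quotient_map_def topspace_quotient_topology
  by (auto simp: openin_quotient_topology quotient_def)

section \<open>Four-bar linkages and their moduli spaces\<close>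

type_synonym quad = "(real^2) \<times> (real^2) \<times> (real^2) \<times> (real^2)"

fun map_quad :: "(real^2 \<Rightarrow> real^2) \<Rightarrow> quad \<Rightarrow> quad" where
  "map_quad f (p1, p2, p3, p4) = (f p1, f p2, f p3, f p4)"

definition plane_isometry :: "(real^2 \<Rightarrow> real^2) \<Rightarrow> bool" where
  "plane_isometry f \<longleftrightarrow> bij f \<and> (\<forall>u v. dist (f u) (f v) = dist u v)"

definition congruence :: "(quad \<times> quad) set" where
  "congruence = {(p, q). \<exists>f. plane_isometry f \<and> q = map_quad f p}"

definition configurations :: "real \<Rightarrow> real \<Rightarrow> real \<Rightarrow> real \<Rightarrow> quad set" where
  "configurations a b c d = {(p1, p2, p3, p4).
     dist p1 p2 = a \<and> dist p2 p3 = b \<and> dist p3 p4 = c \<and> dist p4 p1 = d}"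

definition moduli_space :: "real \<Rightarrow> real \<Rightarrow> real \<Rightarrow> real \<Rightarrow> quad set set" where
  "moduli_space a b c d = configurations a b c d // congruence"

definition moduli_topology :: "real \<Rightarrow> real \<Rightarrow> real \<Rightarrow> real \<Rightarrow> quad set topology" where
  "moduli_topology a b c d = quotient_topology (top_of_set (configurations a b c d)) congruence"

definition nondegenerate :: "real \<Rightarrow> real \<Rightarrow> real \<Rightarrow> real \<Rightarrow> bool" where
  "nondegenerate a b c d \<longleftrightarrow>
     (\<forall>(p1, p2, p3, p4) \<in> configurations a b c d. \<not> collinear {p1, p2, p3, p4})"

section \<open>Convex configurations\<close>

text \<open>A closed polygon is convex if its edges make up the boundary of a convex region, which is
  then the convex hull of the vertices. An angle equal to \<open>\<pi>\<close> is allowed.\<close>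

fun convex_quad :: "quad \<Rightarrow> bool" where
  "convex_quad (p1, p2, p3, p4) \<longleftrightarrow>
     closed_segment p1 p2 \<union> closed_segment p2 p3 \<union> closed_segment p3 p4 \<union> closed_segment p4 p1
       = frontier (convex hull {p1, p2, p3, p4})"

text \<open>The unsigned angle at \<open>v\<close>, in \<open>[0, \<pi>]\<close>. For a convex polygon it is the interior
  angle.\<close>

definition vertex_angle :: "real^2 \<Rightarrow> real^2 \<Rightarrow> real^2 \<Rightarrow> real" where
  "vertex_angle u v w = arccos (((u - v) \<bullet> (w - v)) / (norm (u - v) * norm (w - v)))"

fun strictly_convex_quad :: "quad \<Rightarrow> bool" where
  "strictly_convex_quad (p1, p2, p3, p4) \<longleftrightarrow>
     convex_quad (p1, p2, p3, p4) \<and>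
     vertex_angle p4 p1 p2 < pi \<and> vertex_angle p1 p2 p3 < pi \<and>
     vertex_angle p2 p3 p4 < pi \<and> vertex_angle p3 p4 p1 < pi"

definition convex_moduli :: "real \<Rightarrow> real \<Rightarrow> real \<Rightarrow> real \<Rightarrow> quad set set" where
  "convex_moduli a b c d = {p \<in> configurations a b c d. convex_quad p} // congruence"

definition strictly_convex_moduli :: "real \<Rightarrow> real \<Rightarrow> real \<Rightarrow> real \<Rightarrow> quad set set" where
  "strictly_convex_moduli a b c d =
     {p \<in> configurations a b c d. strictly_convex_quad p} // congruence"

section \<open>The Coulomb potential\<close>

fun quad_potential :: "real \<Rightarrow> quad \<Rightarrow> real" where
  "quad_potential t (p1, p2, p3, p4) = t / dist p1 p3 + 1 / dist p2 p4"

definition coulomb :: "real \<Rightarrow> quad set \<Rightarrow> real" where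
  "coulomb t C = the_elem (quad_potential t ` C)"

section \<open>Well-definedness\<close>

lemma equiv_congruence: "equiv UNIV congruence"
proof (rule equivI)
  have "(p, p) \<in> congruence" for p
  proof -
    have "plane_isometry id" "p = map_quad id p"
      by (cases p; simp add: plane_isometry_def)+
    then show ?thesis unfolding congruence_def by blast
  qed
  then show "refl congruence" by (rule refl_onI)
next
  show "sym congruence"
  proof (rule symI)
    fix p q assume "(p, q) \<in> congruence"
    then obtain f where f: "plane_isometry f" "q = map_quad f p"
      by (auto simp: congruence_def)
    have b: "bij f" using f by (simp add: plane_isometry_def)
    have "dist (inv f u) (inv f v) = dist u v" for u v
    proof -
      have "dist (f (inv f u)) (f (inv f v)) = dist (inv f u) (inv f v)"
        using f(1) unfolding plane_isometry_def by blast
      then show ?thesis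
        using b by (simp add: bij_is_surj surj_f_inv_f)
    qed
    then have "plane_isometry (inv f)"
      using b by (simp add: plane_isometry_def bij_imp_bij_inv)
    moreover have "p = map_quad (inv f) q"
      using b by (cases p) (auto simp: f(2) bij_is_inj)
    ultimately show "(q, p) \<in> congruence" by (auto simp: congruence_def)
  qed
next
  show "trans congruence"
  proof (rule transI)
    fix p q r assume "(p, q) \<in> congruence" "(q, r) \<in> congruence"
    then obtain f g where f: "plane_isometry f" "q = map_quad f p"
      and g: "plane_isometry g" "r = map_quad g q"
      by (auto simp: congruence_def)
    have "plane_isometry (g \<circ> f)"
      using f(1) g(1) by (auto simp: plane_isometry_def bij_comp)
    moreover have "r = map_quad (g \<circ> f) p" by (cases p) (auto simp: f g)
    ultimately show "(p, r) \<in> congruence" by (auto simp: congruence_def)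
  qed
qed auto

lemma congruence_configurations:
  assumes "(p, q) \<in> congruence"
  shows "p \<in> configurations a b c d \<longleftrightarrow> q \<in> configurations a b c d"
  using assms by (cases p) (auto simp: congruence_def plane_isometry_def configurations_def)

lemma coulomb_class: "coulomb t (congruence `` {p}) = quad_potential t p"
proof -
  have "quad_potential t q = quad_potential t p" if "(p, q) \<in> congruence" for q
    using that by (cases p) (auto simp: congruence_def plane_isometry_def)
  moreover have "(p, p) \<in> congruence"
    by (rule equiv_class_self[OF equiv_congruence UNIV_I, simplified])
  ultimately have "quad_potential t ` (congruence `` {p}) = {quad_potential t p}"
    by blast
  then show ?thesis by (simp add: coulomb_def)
qed

lemma topspace_moduli_topology: "topspace (moduli_topology a b c d) = moduli_space a b c d"
  by (simp add: moduli_topology_def moduli_space_def topspace_quotient_topology)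

end

theory Submission
  imports Defs
begin

text \<open>
  The proof rests on one self-stress. For points $p_1,\dots,p_4$ of the plane the signed areas of the
  four triangles give weights $\lambda_i$ with $\sum\lambda_i=0$ and $\sum\lambda_i p_i=0$. For every
  other quadruple $q$ one has
  $\sum_{i<j}\lambda_i\lambda_j|q_iq_j|^2=-|\sum\lambda_i q_i|^2\le 0$, with equality at $q=p$. If $p$ and
  $q$ have the same four sides, the sides cancel, and what is left bounds the two diagonals alone:
  \[\lambda_1\lambda_3(|q_1q_3|^2-|p_1p_3|^2)+\lambda_2\lambda_4(|q_2q_4|^2-|p_2p_4|^2)\le 0\]
  (lemma \<open>stress_inequality\<close>). So, in the plane of squared diagonals, every configuration comes
  with an explicit supporting line of the whole moduli space, and $p$ is convex exactly if both
  coefficients are nonnegative, strictly convex exactly if they are positive (lemmas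
  \<open>convex_quad_iff_tri\<close> and \<open>strictly_convex_quad_iff_tri\<close>).

  The energy $t/x+1/y$ is a strictly convex function of $(x^2,y^2)$. If $p$ is strictly convex, then
  for the charge $t=(\lambda_1\lambda_3x^3)/(\lambda_2\lambda_4y^3)$ its gradient at $p$ is a normal of that
  supporting line, so $p$ is the only minimum point of $E_t$ on the entire moduli space (lemmas
  \<open>supporting_line_minimizes\<close> and \<open>hinge_minimizes\<close>).

  It remains to see that $p\mapsto t$ is a homeomorphism from the strictly convex configurations onto
  $(0,\infty)$ which extends to the end points. Place $p_1,p_3$ on the first axis with $p_2$ below and
  $p_4$ above; the diagonal $x=|p_1p_3|$ is then the only parameter (\<open>hinge\<close>), and every convex
  configuration is congruent to one of these (lemma \<open>congruent_hinge\<close>). Applying the stress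
  inequality to two values of $x$ in both directions shows that the ratio
  $\lambda_1\lambda_3/(\lambda_2\lambda_4)$ is a monotone function of $x$. Hence the convex configurations
  are those with $x_0\le x\le x_{max}$ for a single threshold $x_0$ (lemma \<open>convex_threshold\<close>), and $t$
  increases strictly there (lemma \<open>charge_increasing\<close>), from $0$ at $x_0$, where $p_1$ or $p_3$ is
  flat, to $\infty$ at $x_{max}$, where $p_2$ or $p_4$ is flat. The inverse function is continuous on
  $[0,\infty]$ by compactness of $[x_0,x_{max}]$ (lemma \<open>ennreal_reparametrization\<close>).
\<close>

section \<open>Signed areas and the stress inequality\<close>

text \<open>Twice the signed area of the triangle, positive for counterclockwise order.\<close>

definition tri :: "real^2 \<Rightarrow> real^2 \<Rightarrow> real^2 \<Rightarrow> real" where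
  "tri p q r = (q$1 - p$1) * (r$2 - p$2) - (q$2 - p$2) * (r$1 - p$1)"

lemma tri_rotate: "tri q r p = tri p q r"
  by (simp add: tri_def algebra_simps)

lemma tri_swap: "tri q p r = - tri p q r"
  by (simp add: tri_def algebra_simps)

lemma tri_affine: "u + v = 1 \<Longrightarrow> tri p q (u *\<^sub>R x + v *\<^sub>R y) = u * tri p q x + v * tri p q y"
proof -
  assume "u + v = 1"
  then have u: "u = 1 - v" by simp
  show ?thesis by (simp add: u tri_def algebra_simps)
qed

lemma dist_sq_plane: "(dist p q)\<^sup>2 = (p$1 - q$1)\<^sup>2 + (p$2 - q$2)\<^sup>2" for p q :: "real^2"
  by (simp add: dist_norm norm_vec_def L2_set_def sum_2)

lemma vec2_eq_iff: "p = q \<longleftrightarrow> p$1 = q$1 \<and> p$2 = q$2" for p q :: "real^2"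
  by (simp add: vec_eq_iff forall_2)

text \<open>By the Binet--Cauchy identity, a product of two areas that share the edge $p_1p_3$ is a polynomial
  in inner products, hence in squared distances. So the sign condition that characterizes convexity
  is a congruence invariant, although each single area is one only up to sign.\<close>

lemma tri_product_dist:
  assumes "dist p1 p2 = dist q1 q2" "dist p2 p3 = dist q2 q3" "dist p3 p4 = dist q3 q4"
    "dist p4 p1 = dist q4 q1" "dist p1 p3 = dist q1 q3" "dist p2 p4 = dist q2 q4"
  shows "tri p1 p2 p3 * tri p1 p3 p4 = tri q1 q2 q3 * tri q1 q3 q4"
proof -
  have *: "4 * (tri p1 p2 p3 * tri p1 p3 p4) =
      ((dist p1 p2)\<^sup>2 + (dist p1 p3)\<^sup>2 - (dist p2 p3)\<^sup>2) * ((dist p1 p3)\<^sup>2 + (dist p4 p1)\<^sup>2 - (dist p3 p4)\<^sup>2)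
      - 2 * ((dist p1 p2)\<^sup>2 + (dist p4 p1)\<^sup>2 - (dist p2 p4)\<^sup>2) * (dist p1 p3)\<^sup>2" for p1 p2 p3 p4
    unfolding dist_sq_plane tri_def by algebra
  show ?thesis using *[of p1 p2 p3 p4] *[of q1 q2 q3 q4] assms by simp
qed

text \<open>The weights \<open>l1, \<dots>, l4\<close> in the proof are the affine dependency of the four points $p_i$; the
  left-hand side is then minus the squared norm of the same combination of the $q_i$.\<close>

lemma stress_inequality:
  fixes p1 p2 p3 p4 q1 q2 q3 q4 :: "real^2"
  assumes "dist p1 p2 = dist q1 q2" "dist p2 p3 = dist q2 q3" "dist p3 p4 = dist q3 q4"
    "dist p4 p1 = dist q4 q1"
  shows "tri p2 p3 p4 * tri p1 p2 p4 * ((dist q1 q3)\<^sup>2 - (dist p1 p3)\<^sup>2)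
       + tri p1 p2 p3 * tri p1 p3 p4 * ((dist q2 q4)\<^sup>2 - (dist p2 p4)\<^sup>2) \<le> 0"
proof -
  define l1 l2 l3 l4 where l: "l1 = tri p2 p3 p4" "l2 = - tri p1 p3 p4" "l3 = tri p1 p2 p4"
    "l4 = - tri p1 p2 p3"
  have sum0: "l1 + l2 + l3 + l4 = 0" unfolding l tri_def by algebra
  have *: "l1*l2*(dist r1 r2)\<^sup>2 + l2*l3*(dist r2 r3)\<^sup>2 + l3*l4*(dist r3 r4)\<^sup>2 + l4*l1*(dist r4 r1)\<^sup>2
      + l1*l3*(dist r1 r3)\<^sup>2 + l2*l4*(dist r2 r4)\<^sup>2
      = - (l1*r1$1 + l2*r2$1 + l3*r3$1 + l4*r4$1)\<^sup>2 - (l1*r1$2 + l2*r2$2 + l3*r3$2 + l4*r4$2)\<^sup>2"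
    for r1 r2 r3 r4 :: "real^2"
    using sum0 unfolding dist_sq_plane by algebra
  have dep: "l1*p1$1 + l2*p2$1 + l3*p3$1 + l4*p4$1 = 0" "l1*p1$2 + l2*p2$2 + l3*p3$2 + l4*p4$2 = 0"
    unfolding l tri_def by algebra+
  have "l1*l3*((dist q1 q3)\<^sup>2 - (dist p1 p3)\<^sup>2) + l2*l4*((dist q2 q4)\<^sup>2 - (dist p2 p4)\<^sup>2)
     = - (l1*q1$1 + l2*q2$1 + l3*q3$1 + l4*q4$1)\<^sup>2 - (l1*q1$2 + l2*q2$2 + l3*q3$2 + l4*q4$2)\<^sup>2"
    using *[of q1 q2 q3 q4] *[of p1 p2 p3 p4] assms unfolding dep by (simp add: algebra_simps)
  also have "\<dots> \<le> 0" by (smt (verit) zero_le_power2)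
  finally show ?thesis by (simp add: l algebra_simps)
qed

lemma area_balance: "tri p2 p3 p4 + tri p1 p2 p4 = tri p1 p3 p4 + tri p1 p2 p3"
  unfolding tri_def by algebra

lemma tri_zero_collinear:
  assumes "p1 \<noteq> p2" "tri p1 p2 p3 = 0" "tri p1 p2 p4 = 0"
  shows "collinear {p1, p2, p3, p4}"
proof -
  have *: "\<exists>c. r = p1 + c *\<^sub>R (p2 - p1)" if "tri p1 p2 r = 0" for r
  proof (cases "p2$1 = p1$1")
    case True
    then have n: "p2$2 \<noteq> p1$2" using assms(1) by (simp add: vec2_eq_iff)
    have "r$1 = p1$1" using that True n by (simp add: tri_def)
    then show ?thesis
      using True n
      by (intro exI[of _ "(r$2 - p1$2) / (p2$2 - p1$2)"]) (simp add: vec2_eq_iff)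
  next
    case False
    define c where "c = (r$1 - p1$1) / (p2$1 - p1$1)"
    have c: "r$1 = p1$1 + c * (p2$1 - p1$1)" using False by (simp add: c_def)
    have "(p2$1 - p1$1) * (r$2 - (p1$2 + c * (p2$2 - p1$2))) = 0"
      using that unfolding tri_def c by (simp add: algebra_simps)
    then show ?thesis using False c by (intro exI[of _ c]) (simp add: vec2_eq_iff)
  qed
  have "tri p1 p2 p1 = 0" "tri p1 p2 p2 = 0" by (simp_all add: tri_def)
  then show ?thesis unfolding collinear_alt using *[of p1] *[of p2] *[of p3] *[of p4] assms by blast
qed

lemma affine_dependency:
  "tri p2 p3 p4 *\<^sub>R p1 + tri p1 p2 p4 *\<^sub>R p3 = tri p1 p3 p4 *\<^sub>R p2 + tri p1 p2 p3 *\<^sub>R p4"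
  by (simp add: vec2_eq_iff tri_def algebra_simps)

lemma barycentric:
  "tri p q r *\<^sub>R z = tri q r z *\<^sub>R p + tri r p z *\<^sub>R q + tri p q z *\<^sub>R r"
  by (simp add: vec2_eq_iff tri_def algebra_simps)

lemma tri_sum: "tri q r z + tri r p z + tri p q z = tri p q r"
  unfolding tri_def by algebra

lemma in_triangle:
  assumes "tri p q r > 0" "tri q r z \<ge> 0" "tri r p z \<ge> 0" "tri p q z \<ge> 0"
  shows "z \<in> convex hull {p, q, r}"
proof -
  let ?S = "tri p q r"
  have "z = (1 / ?S) *\<^sub>R (?S *\<^sub>R z)" using assms by simp
  also have "\<dots> = (tri q r z / ?S) *\<^sub>R p + (tri r p z / ?S) *\<^sub>R q + (tri p q z / ?S) *\<^sub>R r"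
    unfolding barycentric[of p q r z] by (simp add: scaleR_add_right)
  finally have z: "z = (tri q r z / ?S) *\<^sub>R p + (tri r p z / ?S) *\<^sub>R q + (tri p q z / ?S) *\<^sub>R r" .
  have "tri q r z / ?S + tri r p z / ?S + tri p q z / ?S = 1"
    using assms(1) tri_sum[of q r z p] by (simp flip: add_divide_distrib)
  moreover have "tri q r z / ?S \<ge> 0" "tri r p z / ?S \<ge> 0" "tri p q z / ?S \<ge> 0" using assms by auto
  ultimately show ?thesis unfolding convex_hull_3 using z by blast
qed

lemma tri_nonneg_hull:
  assumes "\<And>v. v \<in> V \<Longrightarrow> tri p q v \<ge> 0" "z \<in> convex hull V"
  shows "tri p q z \<ge> 0"
proof -
  have "convex {z. tri p q z \<ge> 0}"
    unfolding convex_def by (auto simp: tri_affine)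
  then have "convex hull V \<subseteq> {z. tri p q z \<ge> 0}" using assms by (intro hull_minimal) auto
  then show ?thesis using assms(2) by auto
qed

lemma supporting_line_not_interior:
  assumes "\<And>v. v \<in> S \<Longrightarrow> tri p q v \<ge> 0" "p \<noteq> q" "tri p q z = 0"
  shows "z \<notin> interior S"
proof
  assume "z \<in> interior S"
  then obtain e where e: "e > 0" "cball z e \<subseteq> S" by (auto simp: mem_interior_cball)
  (* n points from the line pq to its negative side. *)
  define n :: "real^2" where "n = vector [q$2 - p$2, p$1 - q$1]"
  have n12: "n$1 = q$2 - p$2" "n$2 = p$1 - q$1" by (simp_all add: n_def)
  have n0: "n \<noteq> 0" using assms(2) by (auto simp: vec2_eq_iff n12)
  define s where "s = e / norm n"
  have s: "s > 0" using e n0 by (simp add: s_def)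
  have "z + s *\<^sub>R n \<in> cball z e" using e n0 by (simp add: s_def dist_norm)
  then have "tri p q (z + s *\<^sub>R n) \<ge> 0" using e assms(1) by blast
  moreover have "tri p q (z + s *\<^sub>R n) = tri p q z - s * ((q$1 - p$1)\<^sup>2 + (q$2 - p$2)\<^sup>2)"
    by (simp add: tri_def n12 algebra_simps power2_eq_square)
  moreover have "(q$1 - p$1)\<^sup>2 + (q$2 - p$2)\<^sup>2 > 0"
    using assms(2) by (auto simp: vec2_eq_iff sum_power2_gt_zero_iff)
  ultimately show False using assms(3) s by (smt (verit) mult_pos_pos)
qed

lemma hull_of_collinear_triple:
  fixes p q r :: "real^2"
  assumes "q \<in> closed_segment p r"
  shows "convex hull {p, q, r} \<subseteq> closed_segment p q \<union> closed_segment q r"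
  unfolding Un_closed_segment[OF assms] using assms by (intro hull_minimal) auto

text \<open>If the triangle at \<open>p2\<close> is flat, the affine dependency writes \<open>p2\<close> as a combination of its two
  neighbours only, and the sign hypothesis makes the combination convex.\<close>

lemma flat_vertex:
  assumes "tri p1 p2 p3 = 0" "tri p1 p3 p4 \<noteq> 0" "tri p2 p3 p4 * tri p1 p2 p4 \<ge> 0"
  shows "p2 \<in> closed_segment p1 p3"
proof -
  let ?S = "tri p1 p3 p4"
  have S: "tri p2 p3 p4 + tri p1 p2 p4 = ?S" using area_balance[of p2 p3 p4 p1] assms by simp
  have "p2 = (1 / ?S) *\<^sub>R (?S *\<^sub>R p2)" using assms by simp
  also have "?S *\<^sub>R p2 = tri p2 p3 p4 *\<^sub>R p1 + tri p1 p2 p4 *\<^sub>R p3"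
    using affine_dependency[of p2 p3 p4 p1] assms by simp
  finally have p2: "p2 = (tri p2 p3 p4 / ?S) *\<^sub>R p1 + (tri p1 p2 p4 / ?S) *\<^sub>R p3"
    by (simp add: scaleR_add_right)
  have e: "tri p2 p3 p4 / ?S = 1 - tri p1 p2 p4 / ?S" using S assms(2) by (simp add: field_simps)
  have "tri p1 p2 p4 / ?S \<ge> 0 \<and> tri p2 p3 p4 / ?S \<ge> 0"
    using S assms(2,3) by (auto simp: zero_le_mult_iff zero_le_divide_iff)
  then show ?thesis unfolding in_segment using p2 e by (intro exI[of _ "tri p1 p2 p4 / ?S"]) auto
qed

section \<open>Convexity in terms of signed areas\<close>

lemma convex_quad_rotate: "convex_quad (p2, p3, p4, p1) = convex_quad (p1, p2, p3, p4)"
proof -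
  have "{p2, p3, p4, p1} = {p1, p2, p3, p4}" by auto
  then show ?thesis by (simp add: Un_ac)
qed

lemma convex_quad_reverse: "convex_quad (p4, p3, p2, p1) = convex_quad (p1, p2, p3, p4)"
proof -
  have "{p4, p3, p2, p1} = {p1, p2, p3, p4}" by auto
  moreover have "closed_segment p4 p3 \<union> closed_segment p3 p2 \<union> closed_segment p2 p1 \<union> closed_segment p1 p4
      = closed_segment p1 p2 \<union> closed_segment p2 p3 \<union> closed_segment p3 p4 \<union> closed_segment p4 p1"
    unfolding closed_segment_commute[of p4 p3] closed_segment_commute[of p3 p2]
      closed_segment_commute[of p2 p1] closed_segment_commute[of p1 p4] by auto
  ultimately show ?thesis by simp
qed

lemma edge_on_boundary:
  assumes ne: "p1 \<noteq> p2" and tri: "tri p1 p2 p3 \<ge> 0" "tri p1 p2 p4 \<ge> 0"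
  shows "closed_segment p1 p2 \<subseteq> frontier (convex hull {p1, p2, p3, p4})"
proof
  fix z assume z: "z \<in> closed_segment p1 p2"
  let ?H = "convex hull {p1, p2, p3, p4}"
  have t12: "tri p1 p2 p1 = 0" "tri p1 p2 p2 = 0" by (simp_all add: tri_def)
  have zH: "z \<in> ?H"
    using z hull_mono[of "{p1, p2}" "{p1, p2, p3, p4}" convex] by (auto simp: segment_convex_hull)
  obtain u where u: "z = (1 - u) *\<^sub>R p1 + u *\<^sub>R p2" using z by (auto simp: in_segment)
  have "tri p1 p2 z = 0" unfolding u by (simp add: tri_affine t12)
  moreover have "tri p1 p2 v \<ge> 0" if "v \<in> ?H" for v
    by (rule tri_nonneg_hull[OF _ that]) (use tri t12 in auto)
  ultimately have "z \<notin> interior ?H"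
    using ne by (intro supporting_line_not_interior[of _ p1 p2]) auto
  with zH show "z \<in> frontier ?H"
    using closure_subset[of ?H] by (auto simp: frontier_def)
qed

text \<open>If \<open>p2\<close> and \<open>p4\<close> lay strictly on the same side of the line \<open>p1 p3\<close>, that line would support
  the hull, so the midpoint of \<open>p1 p3\<close> would be a boundary point. But every edge leaves the line at
  \<open>p1\<close> or \<open>p3\<close>, so no edge contains this midpoint.\<close>

lemma convex_quad_opposite_sides:
  assumes conv: "convex_quad (p1, p2, p3, p4)" and ne: "p1 \<noteq> p3"
  shows "tri p1 p2 p3 * tri p1 p3 p4 \<ge> 0"
proof (rule ccontr)
  assume "\<not> ?thesis"
  then have neg: "tri p1 p3 p2 * tri p1 p3 p4 > 0"
    using tri_swap[of p3 p1 p2] tri_rotate[of p2 p3 p1] tri_rotate[of p1 p3 p2] tri_rotate[of p3 p1 p2]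
    by (simp add: tri_def algebra_simps)
  let ?m = "(1/2) *\<^sub>R p1 + (1/2) *\<^sub>R p3"
  have m: "?m \<in> closed_segment p1 p3" by (auto simp: in_segment intro: exI[of _ "1/2"])
  have "closed_segment p1 p3 \<subseteq> frontier (convex hull {p1, p2, p3, p4})"
  proof (cases "tri p1 p3 p2 > 0")
    case True
    then have "tri p1 p3 p4 > 0" using neg by (simp add: zero_less_mult_iff)
    then have "closed_segment p1 p3 \<subseteq> frontier (convex hull {p1, p3, p2, p4})"
      using True ne by (intro edge_on_boundary) auto
    then show ?thesis by (simp add: insert_commute)
  next
    case False
    then have "tri p1 p3 p2 < 0" "tri p1 p3 p4 < 0" using neg by (auto simp: zero_less_mult_iff)
    then have "closed_segment p3 p1 \<subseteq> frontier (convex hull {p3, p1, p2, p4})"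
      using ne by (intro edge_on_boundary) (auto simp: tri_swap[of p1 p3])
    then show ?thesis by (simp add: insert_commute closed_segment_commute)
  qed
  then have "?m \<in> closed_segment p1 p2 \<union> closed_segment p2 p3 \<union> closed_segment p3 p4 \<union> closed_segment p4 p1"
    using conv m by auto
  moreover have on_edge: "?m \<notin> closed_segment p q" if "p = p1 \<or> p = p3" "tri p1 p3 q \<noteq> 0" for p q
  proof
    assume "?m \<in> closed_segment p q"
    then obtain u where u: "?m = (1 - u) *\<^sub>R p + u *\<^sub>R q" by (auto simp: in_segment)
    have "tri p1 p3 ?m = 0" by (simp add: tri_affine) (simp add: tri_def)
    moreover have "tri p1 p3 p = 0" using that by (auto simp: tri_def)
    ultimately have "u * tri p1 p3 q = 0" unfolding u by (simp add: tri_affine)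
    then have "?m = p" using u that by simp
    then have "(1/2) *\<^sub>R p1 = (1/2) *\<^sub>R p3"
      using that(1) by (auto simp: vec2_eq_iff)
    then show False using ne by simp
  qed
  moreover have "tri p1 p3 p2 \<noteq> 0" "tri p1 p3 p4 \<noteq> 0" using neg by auto
  ultimately show False
    using on_edge unfolding closed_segment_commute[of p2 p3] closed_segment_commute[of p4 p1] by blast
qed

text \<open>The diagonal \<open>p1 p3\<close> cuts the quadrilateral into two triangles; the side of the diagonal on which
  \<open>z\<close> lies tells which of them contains \<open>z\<close>. Only one of the two may be degenerate, and this one
  is avoided when \<open>z\<close> is on the diagonal.\<close>

lemma quad_contains_nonneg:
  assumes nn: "tri p1 p2 p3 \<ge> 0" "tri p1 p3 p4 \<ge> 0" and pos: "tri p1 p2 p3 + tri p1 p3 p4 > 0"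
    and z: "tri p1 p2 z \<ge> 0" "tri p2 p3 z \<ge> 0" "tri p3 p4 z \<ge> 0" "tri p4 p1 z \<ge> 0"
  shows "z \<in> convex hull {p1, p2, p3, p4}"
proof -
  have s: "tri p2 p3 z + tri p3 p1 z + tri p1 p2 z = tri p1 p2 p3"
    "tri p3 p4 z + tri p4 p1 z + tri p1 p3 z = tri p1 p3 p4"
    using tri_sum[of p2 p3 z p1] tri_sum[of p3 p4 z p1] by auto
  have sw: "tri p3 p1 z = - tri p1 p3 z" by (rule tri_swap)
  have "z \<in> convex hull {p1, p2, p3} \<or> z \<in> convex hull {p1, p3, p4}"
  proof (cases "tri p1 p3 z < 0 \<or> tri p1 p3 z = 0 \<and> tri p1 p2 p3 > 0")
    case True
    then show ?thesis using s sw z by (intro disjI1 in_triangle) auto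
  next
    case False
    then show ?thesis using s sw z pos nn by (intro disjI2 in_triangle) auto
  qed
  then show ?thesis
    using hull_mono[of "{p1, p2, p3}" "{p1, p2, p3, p4}" convex]
      hull_mono[of "{p1, p3, p4}" "{p1, p2, p3, p4}" convex] by blast
qed

text \<open>Writing \<open>z\<close> as a convex combination, the two vertices off the line \<open>p1 p2\<close> get weight zero. If
  \<open>p2\<close> or \<open>p1\<close> is flat, a third vertex lies on the line as well; then \<open>z\<close> may lie on the
  adjacent edge, which is why the conclusion does not name the first edge alone.\<close>

lemma on_edge_line:
  assumes nn: "tri p1 p2 p3 \<ge> 0" "tri p1 p3 p4 \<ge> 0" "tri p2 p3 p4 \<ge> 0" "tri p1 p2 p4 \<ge> 0"
    and nz: "tri p1 p2 p3 + tri p1 p2 p4 > 0" "tri p1 p2 p3 + tri p1 p3 p4 > 0"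
      "tri p1 p2 p4 + tri p2 p3 p4 > 0"
    and z: "z \<in> convex hull {p1, p2, p3, p4}" "tri p1 p2 z = 0"
  shows "z \<in> closed_segment p1 p2 \<union> closed_segment p2 p3 \<union> closed_segment p3 p4 \<union> closed_segment p4 p1"
proof -
  have "convex hull {p1, p2, p3, p4} = {x. \<exists>u\<ge>0. \<exists>v\<ge>0. \<exists>b. u + v = 1 \<and> b \<in> convex hull {p2, p3, p4} \<and> x = u *\<^sub>R p1 + v *\<^sub>R b}"
    by (rule convex_hull_insert) simp
  with z(1) obtain u v b where uv: "u \<ge> 0" "v \<ge> 0" "u + v = 1" "b \<in> convex hull {p2, p3, p4}" "z = u *\<^sub>R p1 + v *\<^sub>R b"
    by blast
  from uv(4) obtain r s t where rst: "r \<ge> 0" "s \<ge> 0" "t \<ge> 0" "r + s + t = 1" "b = r *\<^sub>R p2 + s *\<^sub>R p3 + t *\<^sub>R p4"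
    unfolding convex_hull_3 by blast
  define w2 w3 w4 where w: "w2 = v * r" "w3 = v * s" "w4 = v * t"
  have w0: "w2 \<ge> 0" "w3 \<ge> 0" "w4 \<ge> 0" using uv rst by (auto simp: w)
  have sum: "u + w2 + w3 + w4 = 1"
    unfolding w using uv(3) rst(4) by (metis add.assoc distrib_left mult.right_neutral)
  have zw: "z = u *\<^sub>R p1 + w2 *\<^sub>R p2 + w3 *\<^sub>R p3 + w4 *\<^sub>R p4"
    by (simp add: uv(5) rst(5) w scaleR_add_right)
  have u: "u = 1 - w2 - w3 - w4" using sum by simp
  have "tri p1 p2 z = w3 * tri p1 p2 p3 + w4 * tri p1 p2 p4"
    unfolding zw u tri_def by (simp add: algebra_simps)
  then have zz: "w3 * tri p1 p2 p3 = 0" "w4 * tri p1 p2 p4 = 0"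
    using z(2) w0 nn by (smt (verit) mult_nonneg_nonneg)+
  consider "w3 = 0" "w4 = 0" | "tri p1 p2 p3 = 0" "w4 = 0" | "tri p1 p2 p4 = 0" "w3 = 0"
    using zz nz by fastforce
  then show ?thesis
  proof cases
    case 1
    then have "z = (1 - w2) *\<^sub>R p1 + w2 *\<^sub>R p2" using zw u by simp
    then show ?thesis using w0 u uv(1) 1 by (auto simp: in_segment)
  next
    case 2
    then have "z \<in> convex hull {p1, p2, p3}"
      unfolding convex_hull_3 using zw w0 uv(1) sum by auto
    moreover have "p2 \<in> closed_segment p1 p3" using 2 nn nz by (intro flat_vertex[of _ _ _ p4]) auto
    ultimately show ?thesis using hull_of_collinear_triple by blast
  next
    case 3
    then have "z = w4 *\<^sub>R p4 + u *\<^sub>R p1 + w2 *\<^sub>R p2" "w4 + u + w2 = 1" using zw sum by auto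
    then have "z \<in> convex hull {p4, p1, p2}"
      unfolding convex_hull_3 using w0 uv(1) by blast
    moreover have r: "tri p4 p1 p2 = tri p1 p2 p4" "tri p4 p2 p3 = tri p2 p3 p4"
      "tri p4 p1 p3 = tri p1 p3 p4" by (auto simp: tri_def algebra_simps)
    have "p1 \<in> closed_segment p4 p2"
      using 3 nn nz r by (intro flat_vertex[of _ _ _ p3]) auto
    ultimately show ?thesis using hull_of_collinear_triple by blast
  qed
qed

text \<open>The boundary of the hull is contained in the edges because the points with all four areas positive
  form an open subset of the hull: a boundary point must lie on the line of one edge. The sums in the
  hypotheses say that no two vertices are flat.\<close>

lemma convex_quad_ccw:
  assumes nn: "tri p1 p2 p3 \<ge> 0" "tri p1 p3 p4 \<ge> 0" "tri p2 p3 p4 \<ge> 0" "tri p1 p2 p4 \<ge> 0"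
    and nz: "tri p1 p2 p3 + tri p1 p2 p4 > 0" "tri p1 p2 p3 + tri p2 p3 p4 > 0"
      "tri p1 p3 p4 + tri p2 p3 p4 > 0" "tri p1 p3 p4 + tri p1 p2 p4 > 0"
      "tri p1 p2 p3 + tri p1 p3 p4 > 0"
    and ne: "p1 \<noteq> p2" "p2 \<noteq> p3" "p3 \<noteq> p4" "p4 \<noteq> p1"
  shows "convex_quad (p1, p2, p3, p4)"
proof -
  let ?H = "convex hull {p1, p2, p3, p4}"
  let ?E = "closed_segment p1 p2 \<union> closed_segment p2 p3 \<union> closed_segment p3 p4 \<union> closed_segment p4 p1"
  have rot: "{p2, p3, p4, p1} = {p1, p2, p3, p4}" "{p3, p4, p1, p2} = {p1, p2, p3, p4}"
    "{p4, p1, p2, p3} = {p1, p2, p3, p4}" by auto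
  have bal: "tri p1 p2 p4 + tri p2 p3 p4 > 0" using area_balance[of p2 p3 p4 p1] nz by simp
  have r: "tri p2 p3 p1 = tri p1 p2 p3" "tri p2 p4 p1 = tri p1 p2 p4" "tri p3 p4 p1 = tri p1 p3 p4"
    "tri p3 p4 p2 = tri p2 p3 p4" "tri p3 p1 p2 = tri p1 p2 p3" "tri p4 p1 p2 = tri p1 p2 p4"
    "tri p4 p1 p3 = tri p1 p3 p4" "tri p4 p2 p3 = tri p2 p3 p4"
    by (auto simp: tri_def algebra_simps)
  have e: "tri p q p = 0" "tri p q q = 0" for p q by (simp_all add: tri_def)
  have "?E \<subseteq> frontier ?H"
    using edge_on_boundary[of p1 p2 p3 p4] edge_on_boundary[of p2 p3 p4 p1, unfolded rot r]
      edge_on_boundary[of p3 p4 p1 p2, unfolded rot r] edge_on_boundary[of p4 p1 p2 p3, unfolded rot r] nn ne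
    by blast
  moreover have "frontier ?H \<subseteq> ?E"
  proof
    fix z assume "z \<in> frontier ?H"
    moreover have "closed ?H" by (simp add: finite_imp_compact_convex_hull compact_imp_closed)
    ultimately have zH: "z \<in> ?H" "z \<notin> interior ?H" by (auto simp: frontier_def)
    have z: "tri p1 p2 z \<ge> 0" "tri p2 p3 z \<ge> 0" "tri p3 p4 z \<ge> 0" "tri p4 p1 z \<ge> 0"
      by (rule tri_nonneg_hull[OF _ zH(1)], use nn in \<open>auto simp: e r\<close>)+
    let ?U = "{z. tri p1 p2 z > 0} \<inter> {z. tri p2 p3 z > 0} \<inter> {z. tri p3 p4 z > 0} \<inter> {z. tri p4 p1 z > 0}"
    have "open {z. tri p q z > 0}" for p q
      unfolding tri_def by (intro open_Collect_less continuous_intros)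
    then have "open ?U" by (intro open_Int)
    moreover have "?U \<subseteq> ?H" using quad_contains_nonneg[OF nn(1,2) nz(5)] by (auto simp: less_imp_le)
    ultimately have "z \<notin> ?U" using zH(2) interior_maximal by blast
    then consider "tri p1 p2 z = 0" | "tri p2 p3 z = 0" | "tri p3 p4 z = 0" | "tri p4 p1 z = 0"
      using z by force
    then show "z \<in> ?E"
    proof cases
      case 1
      have "z \<in> closed_segment p1 p2 \<union> closed_segment p2 p3 \<union> closed_segment p3 p4 \<union> closed_segment p4 p1"
        by (rule on_edge_line) (use nn nz bal zH 1 in \<open>simp_all add: rot r\<close>)
      then show ?thesis by blast
    next
      case 2
      have "z \<in> closed_segment p2 p3 \<union> closed_segment p3 p4 \<union> closed_segment p4 p1 \<union> closed_segment p1 p2"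
        by (rule on_edge_line) (use nn nz bal zH 2 in \<open>simp_all add: rot r\<close>)
      then show ?thesis by blast
    next
      case 3
      have "z \<in> closed_segment p3 p4 \<union> closed_segment p4 p1 \<union> closed_segment p1 p2 \<union> closed_segment p2 p3"
        by (rule on_edge_line) (use nn nz bal zH 3 in \<open>simp_all add: rot r\<close>)
      then show ?thesis by blast
    next
      case 4
      have "z \<in> closed_segment p4 p1 \<union> closed_segment p1 p2 \<union> closed_segment p2 p3 \<union> closed_segment p3 p4"
        by (rule on_edge_line) (use nn nz bal zH 4 in \<open>simp_all add: rot r\<close>)
      then show ?thesis by blast
    qed
  qed
  ultimately show ?thesis by auto
qed

text \<open>The angle is $\pi$ exactly if the Cauchy--Schwarz inequality is an equality with negative sign, which
  by the law of cosines is the equality case of the triangle inequality.\<close>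

lemma vertex_angle_less_pi_iff:
  assumes "u \<noteq> v" "w \<noteq> v"
  shows "vertex_angle u v w < pi \<longleftrightarrow> v \<notin> closed_segment u w"
proof -
  let ?N = "norm (u - v) * norm (w - v)"
  let ?c = "((u - v) \<bullet> (w - v)) / ?N"
  have N: "?N > 0" using assms by simp
  have "\<bar>(u - v) \<bullet> (w - v)\<bar> \<le> ?N" by (rule Cauchy_Schwarz_ineq2)
  then have c: "\<bar>?c\<bar> \<le> 1" using N by (simp add: abs_mult)
  have d: "(dist u w)\<^sup>2 = (norm (u - v))\<^sup>2 + (norm (w - v))\<^sup>2 - 2 * ((u - v) \<bullet> (w - v))"
    by (simp add: dist_norm power2_norm_eq_inner inner_diff inner_commute)
  have e: "(dist u v + dist v w)\<^sup>2 = (norm (u - v))\<^sup>2 + (norm (w - v))\<^sup>2 + 2 * ?N"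
    by (simp add: power2_sum dist_norm norm_minus_commute[of v w])
  have "arccos ?c < pi \<longleftrightarrow> ?c \<noteq> -1"
  proof
    assume "arccos ?c < pi"
    then show "?c \<noteq> -1" using arccos_minus_1 by fastforce
  next
    assume "?c \<noteq> -1"
    then have "-1 < ?c" "?c \<le> 1" using c by linarith+
    then show "arccos ?c < pi" using arccos_less_arccos[of "-1" ?c] arccos_minus_1 by simp
  qed
  also have "?c \<noteq> -1 \<longleftrightarrow> (u - v) \<bullet> (w - v) \<noteq> - ?N"
    using nonzero_divide_eq_eq[of ?N "(u - v) \<bullet> (w - v)" "-1"] N by fastforce
  also have "\<dots> \<longleftrightarrow> (dist u w)\<^sup>2 \<noteq> (dist u v + dist v w)\<^sup>2"
    unfolding e using d by (smt (verit))
  also have "\<dots> \<longleftrightarrow> dist u w \<noteq> dist u v + dist v w"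
    by (simp add: power2_eq_iff_nonneg)
  also have "\<dots> \<longleftrightarrow> v \<notin> closed_segment u w"
    by (simp add: between flip: between_mem_segment)
  finally show ?thesis by (simp add: vertex_angle_def)
qed

lemma noncollinear_tri:
  assumes "\<not> collinear S" "S = {p, q, r, s}" "p \<noteq> q"
  shows "tri p q r \<noteq> 0 \<or> tri p q s \<noteq> 0"
  using tri_zero_collinear[of p q r s] assms by auto

lemma tri_reverse: "tri r q p = - tri p q r"
  by (simp add: tri_def algebra_simps)

context
  fixes p1 p2 p3 p4 :: "real^2"
  assumes noncollinear: "\<not> collinear {p1, p2, p3, p4}"
    and distinct: "p1 \<noteq> p2" "p2 \<noteq> p3" "p3 \<noteq> p4" "p4 \<noteq> p1" "p1 \<noteq> p3" "p2 \<noteq> p4"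
begin

lemma tri_permute:
  "tri p2 p3 p1 = tri p1 p2 p3" "tri p2 p4 p1 = tri p1 p2 p4" "tri p3 p4 p1 = tri p1 p3 p4"
  "tri p3 p4 p2 = tri p2 p3 p4" "tri p3 p1 p2 = tri p1 p2 p3" "tri p4 p1 p2 = tri p1 p2 p4"
  "tri p4 p1 p3 = tri p1 p3 p4" "tri p4 p2 p3 = tri p2 p3 p4"
  by (simp_all add: tri_def algebra_simps)

lemma no_two_flat:
  "tri p1 p2 p3 \<noteq> 0 \<or> tri p1 p2 p4 \<noteq> 0" "tri p1 p2 p3 \<noteq> 0 \<or> tri p2 p3 p4 \<noteq> 0"
  "tri p1 p3 p4 \<noteq> 0 \<or> tri p2 p3 p4 \<noteq> 0" "tri p1 p3 p4 \<noteq> 0 \<or> tri p1 p2 p4 \<noteq> 0"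
  "tri p1 p2 p3 \<noteq> 0 \<or> tri p1 p3 p4 \<noteq> 0" "tri p1 p2 p4 \<noteq> 0 \<or> tri p2 p3 p4 \<noteq> 0"
proof -
  note nc = noncollinear_tri[OF noncollinear]
  have s: "{p1, p2, p3, p4} = {p1, p3, p2, p4}" "{p1, p2, p3, p4} = {p2, p4, p1, p3}" by auto
  show "tri p1 p2 p3 \<noteq> 0 \<or> tri p1 p2 p4 \<noteq> 0" using nc[of p1 p2 p3 p4] distinct by auto
  show "tri p1 p2 p3 \<noteq> 0 \<or> tri p2 p3 p4 \<noteq> 0" using nc[of p2 p3 p1 p4] distinct
    by (auto simp: tri_permute)
  show "tri p1 p3 p4 \<noteq> 0 \<or> tri p2 p3 p4 \<noteq> 0" using nc[of p3 p4 p1 p2] distinct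
    by (auto simp: tri_permute)
  show "tri p1 p3 p4 \<noteq> 0 \<or> tri p1 p2 p4 \<noteq> 0" using nc[of p4 p1 p2 p3] distinct
    by (auto simp: tri_permute)
  show "tri p1 p2 p3 \<noteq> 0 \<or> tri p1 p3 p4 \<noteq> 0" using nc[OF s(1)] distinct
    by (auto simp: tri_def algebra_simps)
  show "tri p1 p2 p4 \<noteq> 0 \<or> tri p2 p3 p4 \<noteq> 0" using nc[OF s(2)] distinct
    by (auto simp: tri_def algebra_simps)
qed

text \<open>The condition says that each diagonal weakly separates the two other vertices. Since the areas on
  both sides of either diagonal have the same sum, it forces all four areas to have the same sign.\<close>

lemma convex_quad_iff_tri:
  "convex_quad (p1, p2, p3, p4) \<longleftrightarrow>
     tri p1 p2 p3 * tri p1 p3 p4 \<ge> 0 \<and> tri p2 p3 p4 * tri p1 p2 p4 \<ge> 0"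
proof
  assume cv: "convex_quad (p1, p2, p3, p4)"
  then have cv': "convex_quad (p2, p3, p4, p1)" by (simp only: convex_quad_rotate)
  show "tri p1 p2 p3 * tri p1 p3 p4 \<ge> 0 \<and> tri p2 p3 p4 * tri p1 p2 p4 \<ge> 0"
    using convex_quad_opposite_sides[OF cv] convex_quad_opposite_sides[OF cv'] distinct
    by (simp add: tri_permute)
next
  assume nn: "tri p1 p2 p3 * tri p1 p3 p4 \<ge> 0 \<and> tri p2 p3 p4 * tri p1 p2 p4 \<ge> 0"
  note bal = area_balance[of p2 p3 p4 p1]
  have split: "0 \<le> x \<and> 0 \<le> y \<or> x \<le> 0 \<and> y \<le> 0" if "x * y \<ge> 0" for x y :: real
    using that by (auto simp: zero_le_mult_iff)
  have "0 \<le> tri p1 p2 p3 \<and> 0 \<le> tri p1 p3 p4 \<and> 0 \<le> tri p2 p3 p4 \<and> 0 \<le> tri p1 p2 p4 \<or>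
    tri p1 p2 p3 \<le> 0 \<and> tri p1 p3 p4 \<le> 0 \<and> tri p2 p3 p4 \<le> 0 \<and> tri p1 p2 p4 \<le> 0"
    using split[OF conjunct1[OF nn]] split[OF conjunct2[OF nn]] bal by linarith
  then show "convex_quad (p1, p2, p3, p4)"
  proof
    assume "0 \<le> tri p1 p2 p3 \<and> 0 \<le> tri p1 p3 p4 \<and> 0 \<le> tri p2 p3 p4 \<and> 0 \<le> tri p1 p2 p4"
    moreover from this have "tri p1 p2 p3 + tri p1 p2 p4 > 0" "tri p1 p2 p3 + tri p2 p3 p4 > 0"
      "tri p1 p3 p4 + tri p2 p3 p4 > 0" "tri p1 p3 p4 + tri p1 p2 p4 > 0"
      "tri p1 p2 p3 + tri p1 p3 p4 > 0"
      using no_two_flat by (auto simp: add_nonneg_eq_0_iff less_le)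
    ultimately show ?thesis using distinct by (intro convex_quad_ccw) auto
  next
    assume np: "tri p1 p2 p3 \<le> 0 \<and> tri p1 p3 p4 \<le> 0 \<and> tri p2 p3 p4 \<le> 0 \<and> tri p1 p2 p4 \<le> 0"
    have rev: "tri p4 p3 p2 = - tri p2 p3 p4" "tri p4 p2 p1 = - tri p1 p2 p4"
      "tri p3 p2 p1 = - tri p1 p2 p3" "tri p4 p3 p1 = - tri p1 p3 p4" by (rule tri_reverse)+
    have "tri p1 p2 p3 + tri p1 p2 p4 < 0" "tri p1 p2 p3 + tri p2 p3 p4 < 0"
      "tri p1 p3 p4 + tri p2 p3 p4 < 0" "tri p1 p3 p4 + tri p1 p2 p4 < 0"
      "tri p1 p2 p3 + tri p1 p3 p4 < 0"
      using np no_two_flat by (auto simp: add_nonpos_eq_0_iff less_le)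
    then have "convex_quad (p4, p3, p2, p1)"
      using np distinct bal by (intro convex_quad_ccw) (simp_all add: rev)
    then show ?thesis by (simp only: convex_quad_reverse)
  qed
qed

text \<open>A vertex of a convex quadrilateral has angle $\pi$ exactly if its triangle with both neighbours is flat.\<close>

lemma strictly_convex_quad_iff_tri:
  "strictly_convex_quad (p1, p2, p3, p4) \<longleftrightarrow>
     tri p1 p2 p3 * tri p1 p3 p4 > 0 \<and> tri p2 p3 p4 * tri p1 p2 p4 > 0"
proof -
  have flat0: "tri p q r = 0" if seg: "q \<in> closed_segment p r" for p q r
  proof -
    obtain u where u: "q = (1 - u) *\<^sub>R p + u *\<^sub>R r" using seg unfolding in_segment by blast
    show ?thesis unfolding u by (simp add: tri_def algebra_simps)
  qed
  have angles: "strictly_convex_quad (p1, p2, p3, p4) \<longleftrightarrow> convex_quad (p1, p2, p3, p4) \<and>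
      p1 \<notin> closed_segment p4 p2 \<and> p2 \<notin> closed_segment p1 p3 \<and>
      p3 \<notin> closed_segment p2 p4 \<and> p4 \<notin> closed_segment p3 p1"
    using distinct by (simp add: vertex_angle_less_pi_iff del: convex_quad.simps)
  have "(p1 \<notin> closed_segment p4 p2 \<and> p2 \<notin> closed_segment p1 p3 \<and>
      p3 \<notin> closed_segment p2 p4 \<and> p4 \<notin> closed_segment p3 p1) \<longleftrightarrow>
      tri p1 p2 p4 \<noteq> 0 \<and> tri p1 p2 p3 \<noteq> 0 \<and> tri p2 p3 p4 \<noteq> 0 \<and> tri p1 p3 p4 \<noteq> 0"
    if cv: "tri p1 p2 p3 * tri p1 p3 p4 \<ge> 0 \<and> tri p2 p3 p4 * tri p1 p2 p4 \<ge> 0"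
  proof (intro iffI; elim conjE)
    assume out: "p1 \<notin> closed_segment p4 p2" "p2 \<notin> closed_segment p1 p3"
      "p3 \<notin> closed_segment p2 p4" "p4 \<notin> closed_segment p3 p1"
    have "tri p1 p2 p4 \<noteq> 0" using flat_vertex[of p4 p1 p2 p3] out cv no_two_flat
      by (auto simp: tri_permute)
    moreover have "tri p1 p2 p3 \<noteq> 0" using flat_vertex[of p1 p2 p3 p4] out cv no_two_flat by auto
    moreover have "tri p2 p3 p4 \<noteq> 0" using flat_vertex[of p2 p3 p4 p1] out cv no_two_flat
      by (auto simp: tri_permute mult.commute)
    moreover have "tri p1 p3 p4 \<noteq> 0" using flat_vertex[of p3 p4 p1 p2] out cv no_two_flat
      by (auto simp: tri_permute mult.commute)
    ultimately show "tri p1 p2 p4 \<noteq> 0 \<and> tri p1 p2 p3 \<noteq> 0 \<and> tri p2 p3 p4 \<noteq> 0 \<and> tri p1 p3 p4 \<noteq> 0"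
      by blast
  next
    assume nz: "tri p1 p2 p4 \<noteq> 0" "tri p1 p2 p3 \<noteq> 0" "tri p2 p3 p4 \<noteq> 0" "tri p1 p3 p4 \<noteq> 0"
    have "tri p4 p1 p2 \<noteq> 0" "tri p3 p4 p1 \<noteq> 0" using nz by (simp_all add: tri_def algebra_simps)
    then show "p1 \<notin> closed_segment p4 p2 \<and> p2 \<notin> closed_segment p1 p3 \<and>
      p3 \<notin> closed_segment p2 p4 \<and> p4 \<notin> closed_segment p3 p1" using nz flat0 by blast
  qed
  then show ?thesis unfolding angles convex_quad_iff_tri by (auto simp: less_le)
qed

end

section \<open>Triangles on a given base, and isometries\<close>

definition pt :: "real \<Rightarrow> real \<Rightarrow> real^2" where
  "pt x y = (\<chi> i. if i = 1 then x else y)"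

lemma pt_components [simp]: "pt x y $ 1 = x" "pt x y $ 2 = y"
  by (simp_all add: pt_def)

lemma continuous_on_pt:
  assumes "continuous_on S f" "continuous_on S g"
  shows "continuous_on S (\<lambda>x. pt (f x) (g x))"
proof -
  have "continuous_on S (\<lambda>x. if i = 1 then f x else g x)" for i :: 2
    using assms by (cases "i = 1") auto
  then show ?thesis unfolding pt_def by (rule continuous_on_vec_lambda)
qed

text \<open>Coordinates of the apex of a triangle with base from \<open>0\<close> to \<open>x\<close> on the first axis and sides \<open>r\<close>
  at \<open>0\<close> and \<open>s\<close> at \<open>x\<close>. When there is no such triangle, \<open>height\<close> is the (negative) square
  root of a negative number and has no meaning.\<close>

definition foot :: "real \<Rightarrow> real \<Rightarrow> real \<Rightarrow> real" where
  "foot r s x = (r\<^sup>2 - s\<^sup>2 + x\<^sup>2) / (2 * x)"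

definition height :: "real \<Rightarrow> real \<Rightarrow> real \<Rightarrow> real" where
  "height r s x = sqrt (r\<^sup>2 - (foot r s x)\<^sup>2)"

lemma foot_complement: "x > 0 \<Longrightarrow> x - foot r s x = foot s r x"
  by (simp add: foot_def field_simps power2_eq_square)

text \<open>Heron's formula: both sides are four times the square of twice the area. It exhibits the sign of
  the radicand of \<open>height\<close>.\<close>

lemma heron:
  assumes "x > 0"
  shows "4 * x\<^sup>2 * (r\<^sup>2 - (foot r s x)\<^sup>2) = (x\<^sup>2 - (r - s)\<^sup>2) * ((r + s)\<^sup>2 - x\<^sup>2)"
proof -
  have f: "2 * x * foot r s x = r\<^sup>2 - s\<^sup>2 + x\<^sup>2" using assms by (simp add: foot_def)
  show ?thesis using f by algebra
qed

lemma foot_bound: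
  assumes "x > 0" "\<bar>r - s\<bar> \<le> x" "x \<le> r + s"
  shows "(foot r s x)\<^sup>2 \<le> r\<^sup>2"
proof -
  have "(r - s)\<^sup>2 \<le> x\<^sup>2" "x\<^sup>2 \<le> (r + s)\<^sup>2"
    using assms by (simp_all add: abs_le_square_iff[symmetric])
  then have "4 * x\<^sup>2 * (r\<^sup>2 - (foot r s x)\<^sup>2) \<ge> 0" unfolding heron[OF assms(1)] by simp
  then show ?thesis using assms(1) by (simp add: zero_le_mult_iff)
qed

lemma height_sq:
  assumes "x > 0" "\<bar>r - s\<bar> \<le> x" "x \<le> r + s"
  shows "(height r s x)\<^sup>2 = r\<^sup>2 - (foot r s x)\<^sup>2"
  using foot_bound[OF assms] by (simp add: height_def)

lemma height_pos:
  assumes "x > 0" "\<bar>r - s\<bar> < x" "x < r + s"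
  shows "height r s x > 0"
proof -
  have "\<bar>r - s\<bar>\<^sup>2 < x\<^sup>2" "x\<^sup>2 < (r + s)\<^sup>2"
    using assms by (intro power_strict_mono; simp)+
  then have "4 * x\<^sup>2 * (r\<^sup>2 - (foot r s x)\<^sup>2) > 0"
    unfolding heron[OF assms(1)] by (intro mult_pos_pos) simp_all
  then show ?thesis using assms(1) by (simp add: zero_less_mult_iff height_def)
qed

lemma height_nonneg: "x > 0 \<Longrightarrow> \<bar>r - s\<bar> \<le> x \<Longrightarrow> x \<le> r + s \<Longrightarrow> height r s x \<ge> 0"
  using foot_bound by (simp add: height_def)

lemma triangle_apex:
  assumes "x > 0" "X\<^sup>2 + Z\<^sup>2 = r\<^sup>2" "(X - x)\<^sup>2 + Z\<^sup>2 = s\<^sup>2"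
  shows "X = foot r s x" and "\<bar>Z\<bar> = height r s x"
proof -
  have "2 * x * X = r\<^sup>2 - s\<^sup>2 + x\<^sup>2" using assms(2,3) by algebra
  then show X: "X = foot r s x" using assms(1) by (simp add: foot_def field_simps)
  have "Z\<^sup>2 = r\<^sup>2 - (foot r s x)\<^sup>2" using assms(2) X by simp
  then show "\<bar>Z\<bar> = height r s x" unfolding height_def by (metis real_sqrt_abs)
qed

lemma foot_at_sum: "0 < r \<Longrightarrow> 0 < s \<Longrightarrow> foot r s (r + s) = r"
  by (simp add: foot_def field_simps power2_eq_square)

lemma foot_at_diff: "r \<noteq> s \<Longrightarrow> foot r s \<bar>r - s\<bar> = r * sgn (r - s)"
  by (cases "r > s") (simp_all add: foot_def field_simps power2_eq_square)

lemma continuous_on_foot: "(\<And>x. x \<in> S \<Longrightarrow> x > 0) \<Longrightarrow> continuous_on S (foot r s)"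
  unfolding foot_def by (intro continuous_intros) force

lemma continuous_on_height: "(\<And>x. x \<in> S \<Longrightarrow> x > 0) \<Longrightarrow> continuous_on S (height r s)"
  unfolding height_def by (intro continuous_intros continuous_on_foot)

subsection \<open>Congruence\<close>

lemma congruence_dist:
  assumes "((p1, p2, p3, p4), (q1, q2, q3, q4)) \<in> congruence"
  shows "dist p1 p2 = dist q1 q2" "dist p2 p3 = dist q2 q3" "dist p3 p4 = dist q3 q4"
    "dist p4 p1 = dist q4 q1" "dist p1 p3 = dist q1 q3" "dist p2 p4 = dist q2 q4"
  using assms by (auto simp: congruence_def plane_isometry_def)

text \<open>The sign \<open>\<sigma>\<close> chooses between the motion that preserves orientation and its composition with
  the reflection in the first axis.\<close>

lemma rigid_motion_to_axis:
  assumes "p \<noteq> q" "\<sigma>\<^sup>2 = 1"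
  obtains f where "plane_isometry f" "f p = 0" "f q = pt (dist p q) 0"
    "\<And>z. f z $ 2 * dist p q = \<sigma> * tri p q z"
proof -
  define x where "x = dist p q"
  define e1 e2 where e: "e1 = (q$1 - p$1) / x" "e2 = (q$2 - p$2) / x"
  have x: "x > 0" using assms by (simp add: x_def)
  have ex: "q$1 - p$1 = x * e1" "q$2 - p$2 = x * e2" using x by (simp_all add: e)
  have "x\<^sup>2 * (e1\<^sup>2 + e2\<^sup>2) = (q$1 - p$1)\<^sup>2 + (q$2 - p$2)\<^sup>2" unfolding ex by algebra
  also have "\<dots> = x\<^sup>2" unfolding x_def dist_sq_plane by algebra
  finally have e1: "e1\<^sup>2 + e2\<^sup>2 = 1" using x by simp
  define f :: "real^2 \<Rightarrow> real^2" where
    "f z = pt (e1 * (z$1 - p$1) + e2 * (z$2 - p$2)) (\<sigma> * (e1 * (z$2 - p$2) - e2 * (z$1 - p$1)))" for z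
  define g :: "real^2 \<Rightarrow> real^2" where
    "g w = pt (p$1 + e1 * w$1 - \<sigma> * e2 * w$2) (p$2 + e2 * w$1 + \<sigma> * e1 * w$2)" for w
  have "f (g w) = w" "g (f w) = w" for w
    using e1 assms(2) unfolding vec2_eq_iff f_def g_def by (simp_all, algebra+)
  then have "bij f" by (intro bijI') metis+
  moreover have "dist (f u) (f v) = dist u v" for u v
  proof -
    have "(dist (f u) (f v))\<^sup>2 = (dist u v)\<^sup>2"
      using e1 assms(2) unfolding dist_sq_plane f_def pt_components by algebra
    then show ?thesis by (simp add: power2_eq_iff_nonneg)
  qed
  ultimately have "plane_isometry f" by (simp add: plane_isometry_def)
  moreover have "f p = 0" by (simp add: f_def vec2_eq_iff)
  moreover have "f q = pt (dist p q) 0"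
    unfolding f_def ex x_def[symmetric] using e1 by (simp add: vec2_eq_iff) algebra
  moreover have "f z $ 2 * dist p q = \<sigma> * tri p q z" for z
    unfolding f_def tri_def ex x_def[symmetric] by simp algebra
  ultimately show ?thesis using that by blast
qed

text \<open>Stewart's theorem. Below it determines the diagonal \<open>x\<close> of a configuration with a flat vertex
  from the sidelengths.\<close>

lemma stewart:
  fixes p q r s :: "real^2"
  assumes "q \<in> closed_segment p r"
  shows "(dist q s)\<^sup>2 * dist p r =
    dist q r * (dist p s)\<^sup>2 + dist p q * (dist r s)\<^sup>2 - dist p q * dist q r * dist p r"
proof -
  obtain w where w: "0 \<le> w" "w \<le> 1" "q = (1 - w) *\<^sub>R p + w *\<^sub>R r"
    using assms unfolding in_segment by blast
  have "q - p = w *\<^sub>R (r - p)" "r - q = (1 - w) *\<^sub>R (r - p)" by (simp_all add: w(3) algebra_simps)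
  then have n: "norm (q - p) = w * norm (r - p)" "norm (r - q) = (1 - w) * norm (r - p)"
    using w by simp_all
  then have pq: "dist p q = w * dist p r" and qr: "dist q r = (1 - w) * dist p r"
    unfolding dist_norm by (simp_all only: norm_minus_commute[of p q] norm_minus_commute[of q r] norm_minus_commute[of p r])
  have "(dist q s)\<^sup>2 = (1 - w) * (dist p s)\<^sup>2 + w * (dist r s)\<^sup>2 - w * (1 - w) * (dist p r)\<^sup>2"
    unfolding dist_sq_plane w(3) by simp algebra
  then show ?thesis unfolding pq qr by algebra
qed

section \<open>Minima from supporting lines, and reparametrization by the charge\<close>

text \<open>The tangent line at \<open>x\<^sup>2\<close> of the strictly convex function $\xi\mapsto\xi^{-1/2}$.\<close>

lemma inverse_tangent:
  fixes x x' :: real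
  assumes "x > 0" "x' > 0"
  shows "1/x' \<ge> 1/x - (x'\<^sup>2 - x\<^sup>2) / (2*x^3)"
    and "x' \<noteq> x \<Longrightarrow> 1/x' > 1/x - (x'\<^sup>2 - x\<^sup>2) / (2*x^3)"
proof -
  have e: "1/x' - (1/x - (x'\<^sup>2 - x\<^sup>2) / (2*x^3)) = (x'-x)\<^sup>2 * (x'+2*x) / (2*x^3*x')"
    using assms by (simp add: field_simps power2_eq_square power3_eq_cube)
  have "(x'-x)\<^sup>2 * (x'+2*x) / (2*x^3*x') \<ge> 0" using assms by simp
  with e show "1/x' \<ge> 1/x - (x'\<^sup>2 - x\<^sup>2) / (2*x^3)" by linarith
  assume "x' \<noteq> x"
  then have "(x'-x)\<^sup>2 * (x'+2*x) / (2*x^3*x') > 0" using assms by simp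
  with e show "1/x' > 1/x - (x'\<^sup>2 - x\<^sup>2) / (2*x^3)" by linarith
qed

text \<open>The supporting line with slope \<open>- g\<close> in the plane of squared diagonals is orthogonal to the
  gradient of the energy precisely for this value of \<open>t\<close>; convexity of the energy does the rest.\<close>

lemma supporting_line_minimizes:
  fixes x y x' y' g t :: real
  assumes pos: "x > 0" "y > 0" "x' > 0" "y' > 0" "t > 0"
    and supp: "g * (x'\<^sup>2 - x\<^sup>2) + (y'\<^sup>2 - y\<^sup>2) \<le> 0"
    and t: "t = g * x^3 / y^3"
  shows "t / x + 1 / y \<le> t / x' + 1 / y'"
    and "t / x' + 1 / y' \<le> t / x + 1 / y \<Longrightarrow> x' = x \<and> y' = y"
proof -
  have gx: "t / (2*x^3) = g / (2*y^3)" using t pos by simp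
  have "t * (x'\<^sup>2 - x\<^sup>2) / (2*x^3) + (y'\<^sup>2 - y\<^sup>2) / (2*y^3)
     = (t / (2*x^3)) * (x'\<^sup>2 - x\<^sup>2) + (y'\<^sup>2 - y\<^sup>2) / (2*y^3)" by simp
  also have "\<dots> = (g * (x'\<^sup>2 - x\<^sup>2) + (y'\<^sup>2 - y\<^sup>2)) / (2*y^3)"
    unfolding gx by (simp add: add_divide_distrib)
  also have "\<dots> \<le> 0" using supp pos by (simp add: divide_nonpos_pos)
  finally have s: "t * (x'\<^sup>2 - x\<^sup>2) / (2*x^3) + (y'\<^sup>2 - y\<^sup>2) / (2*y^3) \<le> 0" .
  have tx: "t / x' \<ge> t / x - t * (x'\<^sup>2 - x\<^sup>2) / (2*x^3)"
    using mult_left_mono[OF inverse_tangent(1)[OF pos(1,3)], of t] pos by (simp add: algebra_simps)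
  have ty: "1 / y' \<ge> 1 / y - (y'\<^sup>2 - y\<^sup>2) / (2*y^3)"
    using inverse_tangent(1)[OF pos(2,4)] .
  show "t / x + 1 / y \<le> t / x' + 1 / y'" using s tx ty by linarith
  assume le: "t / x' + 1 / y' \<le> t / x + 1 / y"
  have "x' = x"
  proof (rule ccontr)
    assume "x' \<noteq> x"
    then have "t / x' > t / x - t * (x'\<^sup>2 - x\<^sup>2) / (2*x^3)"
      using mult_strict_left_mono[OF inverse_tangent(2)[OF pos(1,3)], of t] pos by (simp add: algebra_simps)
    with s ty le show False by linarith
  qed
  moreover have "y' = y"
  proof (rule ccontr)
    assume "y' \<noteq> y"
    then have "1 / y' > 1 / y - (y'\<^sup>2 - y\<^sup>2) / (2*y^3)"
      using inverse_tangent(2)[OF pos(2,4)] by simp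
    with s tx le show False by linarith
  qed
  ultimately show "x' = x \<and> y' = y" ..
qed

text \<open>\<open>N / D\<close> is an increasing bijection from \<open>{l..r}\<close> to $[0,\infty]$ and \<open>X\<close> is its inverse. Since
  the quotient becomes infinite at \<open>r\<close>, the proof inverts \<open>T = 1 + N / D\<close> instead, written as the
  reciprocal of the finite real function \<open>S = D / (N + D)\<close>; the reciprocal is continuous on the
  extended nonnegative reals, including the value \<open>inverse 0 = \<infinity>\<close>.\<close>

lemma ennreal_reparametrization:
  fixes N D :: "real \<Rightarrow> real"
  assumes lt: "l < r"
    and cont: "continuous_on {l..r} N" "continuous_on {l..r} D"
    and N: "N l = 0" "\<And>x. l < x \<Longrightarrow> x \<le> r \<Longrightarrow> N x > 0"
    and D: "D r = 0" "\<And>x. l \<le> x \<Longrightarrow> x < r \<Longrightarrow> D x > 0"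
    and mono: "\<And>x y. l \<le> x \<Longrightarrow> x < y \<Longrightarrow> y \<le> r \<Longrightarrow> N x * D y < N y * D x"
  obtains X :: "ennreal \<Rightarrow> real" where "continuous_on UNIV X" "bij_betw X UNIV {l..r}"
    "\<And>t. t > 0 \<Longrightarrow> X (ennreal t) \<in> {l<..<r} \<and> N (X (ennreal t)) = t * D (X (ennreal t))"
    "\<And>x. x \<in> {l<..<r} \<Longrightarrow> \<exists>t>0. X (ennreal t) = x"
proof -
  have nonneg: "N x \<ge> 0" "D x \<ge> 0" and sum: "N x + D x > 0" if "x \<in> {l..r}" for x
  proof -
    have "x = l \<or> l < x" "x = r \<or> x < r" using that by auto
    then show "N x \<ge> 0" "D x \<ge> 0" "N x + D x > 0"
      using N(1) N(2)[of x] D(1) D(2)[of x] lt that by fastforce+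
  qed
  define S where "S x = D x / (N x + D x)" for x
  define T where "T x = inverse (ennreal (S x))" for x
  have "continuous_on {l..r} S"
    unfolding S_def using cont sum by (intro continuous_intros) force+
  then have contT: "continuous_on {l..r} T"
    unfolding T_def by (intro continuous_intros continuous_on_ennreal)
  have S_ge: "S x \<ge> 0" if "x \<in> {l..r}" for x using nonneg[OF that] by (simp add: S_def)
  have S_le: "S x \<le> 1" if "x \<in> {l..r}" for x
    using nonneg[OF that] sum[OF that] by (simp add: S_def)
  have S_less: "S y < S x" if "l \<le> x" "x < y" "y \<le> r" for x y
    using mono[OF that] sum[of x] sum[of y] that by (simp add: S_def divide_simps algebra_simps)
  have ends: "S l = 1" "S r = 0" using N(1) D(1) D(2)[of l] lt by (simp_all add: S_def)
  have injS: "inj_on S {l..r}"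
    by (rule linorder_inj_onI') (use S_less in fastforce)
  have T_val: "T x = (if S x = 0 then top else ennreal (1 / S x))" if "x \<in> {l..r}" for x
    using S_ge[OF that] by (simp add: T_def inverse_ennreal inverse_eq_divide)
  have injT: "inj_on T {l..r}"
  proof (rule inj_onI)
    fix x y assume xy: "x \<in> {l..r}" "y \<in> {l..r}" "T x = T y"
    then have "S x = S y" using S_ge[of x] S_ge[of y] by (auto simp: T_val split: if_splits)
    then show "x = y" using injS xy by (simp add: inj_on_def)
  qed
  have T1: "T x \<ge> 1" if "x \<in> {l..r}" for x
  proof (cases "S x = 0")
    case False
    then have "1 \<le> 1 / S x" using S_ge[OF that] S_le[OF that] by simp
    then have "ennreal 1 \<le> ennreal (1 / S x)" by (rule ennreal_leI)
    then show ?thesis using False that by (simp add: T_val)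
  qed (use that in \<open>simp add: T_val\<close>)
  have Tends: "T l = 1" "T r = top" by (simp_all add: T_def ends)
  have imT: "T ` {l..r} = {1..}"
  proof
    show "{1..} \<subseteq> T ` {l..r}"
    proof
      fix z :: ennreal assume "z \<in> {1..}"
      then have "\<exists>x. l \<le> x \<and> x \<le> r \<and> T x = z"
        using lt contT Tends by (intro IVT') auto
      then show "z \<in> T ` {l..r}" by auto
    qed
  qed (use T1 in auto)
  define X where "X t = inv_into {l..r} T (1 + t)" for t
  have "1 + t \<in> T ` {l..r}" for t unfolding imT by simp
  then have X_in: "X t \<in> {l..r}" and TX: "T (X t) = 1 + t" for t
    unfolding X_def by (rule inv_into_into, rule f_inv_into_f)
  have X_eq: "X t = x" if "x \<in> {l..r}" "T x = 1 + t" for x t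
    using that injT unfolding X_def by (metis inv_into_f_eq)
  have contX: "continuous_on UNIV X"
  proof -
    have "continuous_on (T ` {l..r}) (inv_into {l..r} T)"
      using contT injT by (intro continuous_on_inv) auto
    then have "continuous_on {1..} (inv_into {l..r} T)" by (simp only: imT)
    moreover have "continuous_on UNIV (\<lambda>t::ennreal. 1 + t)"
      by (intro continuous_on_add_ennreal continuous_intros)
    moreover have "range (\<lambda>t::ennreal. 1 + t) \<subseteq> {1..}" by (rule image_subsetI) simp
    ultimately have "continuous_on UNIV (\<lambda>t. inv_into {l..r} T (1 + t))"
      by (rule continuous_on_compose2)
    then show ?thesis by (simp only: X_def[abs_def])
  qed
  have "inj X"
  proof (rule injI)
    fix s t assume "X s = X t"
    then have "T (X s) = T (X t)" by (rule arg_cong)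
    then have "1 + s = 1 + t" unfolding TX .
    then show "s = t" by (simp only: ennreal_add_left_cancel) simp
  qed
  moreover have "range X = {l..r}"
  proof
    show "{l..r} \<subseteq> range X"
    proof
      fix x assume x: "x \<in> {l..r}"
      have "1 + (T x - 1) = T x" using T1[OF x] by (simp add: add_diff_inverse_ennreal)
      then have "X (T x - 1) = x" by (intro X_eq[OF x]) (rule sym)
      then show "x \<in> range X" by (metis rangeI)
    qed
  qed (use X_in in blast)
  ultimately have bijX: "bij_betw X UNIV {l..r}" by (simp add: bij_betw_def)
  have fwd: "X (ennreal t) \<in> {l<..<r} \<and> N (X (ennreal t)) = t * D (X (ennreal t))" if t: "t > 0" for t
  proof -
    let ?x = "X (ennreal t)"
    have Tx: "T ?x = ennreal (1 + t)" using TX t by (simp add: ennreal_plus)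
    have "T ?x \<noteq> top" by (simp only: Tx ennreal_neq_top not_False_eq_True)
    moreover have "T ?x \<noteq> 1" unfolding Tx using t by (simp only: ennreal_eq_1)
    ultimately have "?x \<noteq> r" "?x \<noteq> l" using Tends by auto
    then have x: "?x \<in> {l<..<r}" using X_in[of "ennreal t"] by auto
    then have D0: "D ?x > 0" and "N ?x > 0" using D N by auto
    then have S0: "S ?x > 0" by (simp add: S_def)
    then have "ennreal (1 / S ?x) = ennreal (1 + t)"
      using Tx T_val[OF X_in[of "ennreal t"]] by (simp only: if_False less_irrefl split: if_splits)
    then have "1 / S ?x = 1 + t" using S0 t by (subst (asm) ennreal_inj) auto
    then have "N ?x = t * D ?x" using D0 by (simp add: S_def field_simps)
    then show ?thesis using x by simp
  qed
  have bwd: "\<exists>t>0. X (ennreal t) = x" if x: "x \<in> {l<..<r}" for x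
  proof -
    have ND: "D x > 0" "N x > 0" using D N x by auto
    have S0: "S x > 0" and "1 / S x = 1 + N x / D x" using ND by (simp_all add: S_def field_simps)
    then have "T x = ennreal (1 + N x / D x)" using T_val[of x] x by simp
    also have "\<dots> = 1 + ennreal (N x / D x)" using ND by (subst ennreal_plus) simp_all
    finally have "X (ennreal (N x / D x)) = x" using x by (intro X_eq) auto
    then show ?thesis using ND by (intro exI[of _ "N x / D x"]) simp
  qed
  show ?thesis using that[OF contX bijX fwd bwd] .
qed

section \<open>The linkage and its hinge family\<close>

locale four_bar =
  fixes a b c d :: real
  assumes pos: "a > 0" "b > 0" "c > 0" "d > 0"
    and nonempty: "moduli_space a b c d \<noteq> {}"
    and nondeg: "nondegenerate a b c d"
begin

lemma no_collinear_configuration: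
  "\<not> (\<bar>s1 - s2\<bar> = a \<and> \<bar>s2 - s3\<bar> = b \<and> \<bar>s3 - s4\<bar> = c \<and> \<bar>s4 - s1\<bar> = d)"
proof
  assume h: "\<bar>s1 - s2\<bar> = a \<and> \<bar>s2 - s3\<bar> = b \<and> \<bar>s3 - s4\<bar> = c \<and> \<bar>s4 - s1\<bar> = d"
  have dist: "dist (pt s 0) (pt t 0) = \<bar>s - t\<bar>" for s t
    by (rule power2_eq_imp_eq) (simp_all add: dist_sq_plane)
  have "(pt s1 0, pt s2 0, pt s3 0, pt s4 0) \<in> configurations a b c d"
    using h by (simp add: configurations_def dist)
  moreover have "collinear {pt s1 0, pt s2 0, pt s3 0, pt s4 0}"
  proof -
    have "pt s 0 = 0 + s *\<^sub>R pt 1 0" for s by (simp add: vec2_eq_iff)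
    then show ?thesis unfolding collinear_alt by blast
  qed
  ultimately show False using nondeg by (auto simp: nondegenerate_def)
qed

text \<open>A signed sum of the sidelengths that vanishes would let the linkage fold onto a line. These are the
  sign patterns that occur below.\<close>

lemma side_sums: "a + b \<noteq> c + d" "a + d \<noteq> b + c" "\<bar>a - b\<bar> \<noteq> \<bar>c - d\<bar>"
  "\<bar>a - b\<bar> \<noteq> c + d" "\<bar>c - d\<bar> \<noteq> a + b"
  using no_collinear_configuration[of 0 a "a + b" d] no_collinear_configuration[of 0 a "a + b" "-d"]
    no_collinear_configuration[of 0 a "a - b" d] no_collinear_configuration[of 0 a "a - b" "-d"] pos
  by (auto simp: abs_if split: if_splits)

text \<open>The extreme values of the diagonal $x=|p_1p_3|$ allowed by the triangle inequalities.\<close>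

definition x_min where "x_min = max \<bar>a - b\<bar> \<bar>c - d\<bar>"
definition x_max where "x_max = min (a + b) (c + d)"

lemma configuration_range:
  assumes "(p1, p2, p3, p4) \<in> configurations a b c d"
  shows "dist p1 p3 \<in> {x_min..x_max}"
proof -
  have "dist p1 p2 = a" "dist p2 p3 = b" "dist p3 p4 = c" "dist p4 p1 = d"
    using assms by (auto simp: configurations_def)
  then show ?thesis
    unfolding x_min_def x_max_def
    using dist_triangle[of p1 p3 p2] dist_triangle[of p1 p2 p3] dist_triangle[of p2 p3 p1]
      dist_triangle[of p1 p3 p4] dist_triangle[of p1 p4 p3] dist_triangle[of p4 p3 p1]
    by (auto simp: dist_commute abs_le_iff)
qed

lemma x_min_pos: "x_min > 0" using side_sums unfolding x_min_def by auto

lemma x_min_less_x_max: "x_min < x_max"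
proof -
  obtain p where "p \<in> configurations a b c d"
    using nonempty by (auto simp: moduli_space_def quotient_def)
  then have "x_min \<le> x_max" by (cases p) (use configuration_range in force)
  moreover have "x_min \<noteq> x_max" using side_sums pos unfolding x_min_def x_max_def max_def min_def by auto
  ultimately show ?thesis by simp
qed

lemma diagonals_pos:
  assumes "(p1, p2, p3, p4) \<in> configurations a b c d"
  shows "dist p1 p3 > 0" "dist p2 p4 > 0"
proof -
  show "dist p1 p3 > 0" using configuration_range[OF assms] x_min_pos unfolding atLeastAtMost_iff by linarith
  show "dist p2 p4 > 0"
    using assms side_sums by (auto simp: configurations_def dist_commute)
qed

lemma configuration_generic:
  assumes "(p1, p2, p3, p4) \<in> configurations a b c d"
  shows "\<not> collinear {p1, p2, p3, p4}"
    "p1 \<noteq> p2" "p2 \<noteq> p3" "p3 \<noteq> p4" "p4 \<noteq> p1" "p1 \<noteq> p3" "p2 \<noteq> p4"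
proof -
  show "\<not> collinear {p1, p2, p3, p4}" using assms nondeg unfolding nondegenerate_def by fast
  show "p1 \<noteq> p2" "p2 \<noteq> p3" "p3 \<noteq> p4" "p4 \<noteq> p1" using assms pos by (auto simp: configurations_def)
  show "p1 \<noteq> p3" "p2 \<noteq> p4" using diagonals_pos[OF assms] by auto
qed

abbreviation "u \<equiv> foot a b"
abbreviation "v \<equiv> foot d c"
abbreviation "h \<equiv> height a b"
abbreviation "k \<equiv> height d c"

text \<open>The configurations in which \<open>p2\<close> and \<open>p4\<close> are on opposite sides of the diagonal \<open>p1 p3\<close>:
  two triangles hinged along the first axis. The other diagonal has length \<open>diag x\<close>, and
  \<open>area124\<close>, \<open>area234\<close> are the doubled signed areas of the triangles that it cuts off.\<close>

definition hinge :: "real \<Rightarrow> quad" where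
  "hinge x = (0, pt (u x) (- h x), pt x 0, pt (v x) (k x))"

definition diag :: "real \<Rightarrow> real" where
  "diag x = sqrt ((u x - v x)\<^sup>2 + (h x + k x)\<^sup>2)"

definition area124 :: "real \<Rightarrow> real" where "area124 x = u x * k x + v x * h x"
definition area234 :: "real \<Rightarrow> real" where "area234 x = (x - u x) * k x + (x - v x) * h x"

lemma in_range:
  assumes "x \<in> {x_min..x_max}"
  shows "x > 0" "\<bar>a - b\<bar> \<le> x" "x \<le> a + b" "\<bar>d - c\<bar> \<le> x" "x \<le> d + c"
  using assms x_min_pos by (auto simp: x_min_def x_max_def abs_minus_commute)

lemma hinge_dist:
  "dist (0::real^2) (pt x 0) = \<bar>x\<bar>" "dist (pt (u x) (- h x)) (pt (v x) (k x)) = diag x"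
proof -
  have "(dist (0::real^2) (pt x 0))\<^sup>2 = \<bar>x\<bar>\<^sup>2" unfolding dist_sq_plane by simp
  then show "dist (0::real^2) (pt x 0) = \<bar>x\<bar>" by (rule power2_eq_imp_eq) simp_all
  have diag_sq: "(diag x)\<^sup>2 = (u x - v x)\<^sup>2 + (h x + k x)\<^sup>2" by (simp add: diag_def)
  have "(dist (pt (u x) (- h x)) (pt (v x) (k x)))\<^sup>2 = (diag x)\<^sup>2"
    unfolding dist_sq_plane diag_sq pt_components by algebra
  then show "dist (pt (u x) (- h x)) (pt (v x) (k x)) = diag x"
    by (rule power2_eq_imp_eq) (simp_all add: diag_def)
qed

lemma hinge_configuration:
  assumes "x \<in> {x_min..x_max}"
  shows "hinge x \<in> configurations a b c d"
proof -
  note r = in_range[OF assms]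
  have hk: "(h x)\<^sup>2 = a\<^sup>2 - (u x)\<^sup>2" "(k x)\<^sup>2 = d\<^sup>2 - (v x)\<^sup>2" using r by (simp_all add: height_sq)
  have uv: "2 * x * u x = a\<^sup>2 - b\<^sup>2 + x\<^sup>2" "2 * x * v x = d\<^sup>2 - c\<^sup>2 + x\<^sup>2" using r by (simp_all add: foot_def)
  have "(dist 0 (pt (u x) (- h x)))\<^sup>2 = a\<^sup>2" "(dist (pt (u x) (- h x)) (pt x 0))\<^sup>2 = b\<^sup>2"
    "(dist (pt x 0) (pt (v x) (k x)))\<^sup>2 = c\<^sup>2" "(dist (pt (v x) (k x)) 0)\<^sup>2 = d\<^sup>2"
    unfolding dist_sq_plane pt_components zero_index using hk uv by algebra+
  then show ?thesis using pos unfolding hinge_def configurations_def by (simp add: power2_eq_iff_nonneg)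
qed

lemma hinge_tri:
  shows "tri 0 (pt (u x) (- h x)) (pt x 0) = x * h x" "tri 0 (pt x 0) (pt (v x) (k x)) = x * k x"
    "tri 0 (pt (u x) (- h x)) (pt (v x) (k x)) = area124 x"
    "tri (pt (u x) (- h x)) (pt x 0) (pt (v x) (k x)) = area234 x"
  by (simp_all add: tri_def area124_def area234_def algebra_simps)

text \<open>The orientation of the motion is chosen so that \<open>p2\<close> goes below the axis and \<open>p4\<close> above; as they
  are on opposite sides of the diagonal, one choice serves both, even if one of the two areas is \<open>0\<close>.\<close>

lemma congruent_hinge:
  assumes p: "(p1, p2, p3, p4) \<in> configurations a b c d"
    and opp: "tri p1 p2 p3 * tri p1 p3 p4 \<ge> 0"
  shows "((p1, p2, p3, p4), hinge (dist p1 p3)) \<in> congruence"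
proof -
  let ?x = "dist p1 p3"
  have x: "?x > 0" using diagonals_pos[OF p] by simp
  define \<sigma> :: real where "\<sigma> = (if tri p1 p2 p3 < 0 \<or> tri p1 p3 p4 < 0 then -1 else 1)"
  have \<sigma>: "\<sigma>\<^sup>2 = 1" by (simp add: \<sigma>_def)
  have side: "\<sigma> * tri p1 p2 p3 \<ge> 0" "\<sigma> * tri p1 p3 p4 \<ge> 0"
    using opp by (auto simp: \<sigma>_def zero_le_mult_iff)
  have ne: "p1 \<noteq> p3" using x by auto
  obtain f where f: "plane_isometry f" "f p1 = 0" "f p3 = pt ?x 0"
    "\<And>z. f z $ 2 * ?x = \<sigma> * tri p1 p3 z"
    using rigid_motion_to_axis[OF ne \<sigma>] by blast
  have iso: "dist (f z) (f w) = dist z w" for z w using f(1) by (simp add: plane_isometry_def)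
  have apex: "f z = pt (foot r s ?x) (f z $ 2)" "\<bar>f z $ 2\<bar> = height r s ?x"
    if "dist p1 z = r" "dist z p3 = s" for z r s
  proof -
    have "(dist 0 (f z))\<^sup>2 = r\<^sup>2" "(dist (f z) (pt ?x 0))\<^sup>2 = s\<^sup>2"
      using iso[of p1 z] iso[of z p3] that f by simp_all
    then have *: "(f z $ 1)\<^sup>2 + (f z $ 2)\<^sup>2 = r\<^sup>2" "(f z $ 1 - ?x)\<^sup>2 + (f z $ 2)\<^sup>2 = s\<^sup>2"
      unfolding dist_sq_plane by simp_all
    show "f z = pt (foot r s ?x) (f z $ 2)" "\<bar>f z $ 2\<bar> = height r s ?x"
      using triangle_apex[OF x *] by (simp_all add: vec2_eq_iff)
  qed
  have "f p2 $ 2 * ?x \<le> 0" "f p4 $ 2 * ?x \<ge> 0"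
    using f(4)[of p2] f(4)[of p4] side by (simp_all add: tri_def algebra_simps)
  then have "f p2 $ 2 \<le> 0" "f p4 $ 2 \<ge> 0" using x by (simp_all add: mult_le_0_iff zero_le_mult_iff)
  moreover have "dist p1 p2 = a" "dist p2 p3 = b" "dist p1 p4 = d" "dist p4 p3 = c"
    using p by (auto simp: configurations_def dist_commute)
  ultimately have "f p2 $ 2 = - h ?x" "f p4 $ 2 = k ?x" "f p2 = pt (u ?x) (f p2 $ 2)" "f p4 = pt (v ?x) (f p4 $ 2)"
    using apex[of p2 a b] apex[of p4 d c] by linarith+
  then have "f p2 = pt (u ?x) (- h ?x)" "f p4 = pt (v ?x) (k ?x)" by simp_all
  then have "hinge ?x = map_quad f (p1, p2, p3, p4)" by (simp add: hinge_def f)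
  then show ?thesis using f(1) by (auto simp: congruence_def)
qed

section \<open>The stress along the hinge family\<close>

text \<open>The coefficients $\lambda_1\lambda_3$ and $\lambda_2\lambda_4$ of the stress inequality, which belong to
  the diagonals $p_1p_3$ and $p_2p_4$.\<close>

definition stress13 :: "real \<Rightarrow> real" where "stress13 x = area234 x * area124 x"
definition stress24 :: "real \<Rightarrow> real" where "stress24 x = x * h x * (x * k x)"

lemma hinge_stress:
  assumes x: "x \<in> {x_min..x_max}" and q: "(q1, q2, q3, q4) \<in> configurations a b c d"
  shows "stress13 x * ((dist q1 q3)\<^sup>2 - x\<^sup>2) + stress24 x * ((dist q2 q4)\<^sup>2 - (diag x)\<^sup>2) \<le> 0"
proof -
  have "\<bar>x\<bar> = x" using in_range(1)[OF x] by simp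
  then show ?thesis
    using stress_inequality[of 0 "pt (u x) (- h x)" q1 q2 "pt x 0" q3 "pt (v x) (k x)" q4]
      hinge_configuration[OF x] q
    by (simp only: hinge_def configurations_def mem_Collect_eq prod.case hinge_tri hinge_dist
        stress13_def stress24_def)
qed

lemma hinge_hinge_stress:
  assumes x: "x \<in> {x_min..x_max}" and y: "y \<in> {x_min..x_max}"
  shows "stress13 x * (y\<^sup>2 - x\<^sup>2) + stress24 x * ((diag y)\<^sup>2 - (diag x)\<^sup>2) \<le> 0"
  using hinge_stress[OF x hinge_configuration[OF y, unfolded hinge_def]] in_range(1)[OF y]
  by (simp only: hinge_dist abs_of_pos)

lemma hinge_convex_iff:
  assumes x: "x \<in> {x_min..x_max}"
  shows "convex_quad (hinge x) \<longleftrightarrow> stress24 x \<ge> 0 \<and> stress13 x \<ge> 0"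
    "strictly_convex_quad (hinge x) \<longleftrightarrow> stress24 x > 0 \<and> stress13 x > 0"
  using convex_quad_iff_tri[OF configuration_generic[OF hinge_configuration[OF x, unfolded hinge_def]]]
    strictly_convex_quad_iff_tri[OF configuration_generic[OF hinge_configuration[OF x, unfolded hinge_def]]]
  unfolding hinge_def hinge_tri stress13_def stress24_def by simp_all

lemma interior_heights:
  assumes "x_min < x" "x < x_max"
  shows "h x > 0" "k x > 0" "stress24 x > 0" "area124 x + area234 x > 0"
proof -
  have x: "x > 0" using x_min_pos assms by simp
  show hk: "h x > 0" "k x > 0" using assms x by (auto intro!: height_pos simp: x_min_def x_max_def)
  show "stress24 x > 0" using x hk by (simp add: stress24_def)
  have "area124 x + area234 x = x * (h x + k x)" unfolding area124_def area234_def by algebra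
  then show "area124 x + area234 x > 0" using x hk by simp
qed

lemma stress24_nonneg: "x \<in> {x_min..x_max} \<Longrightarrow> stress24 x \<ge> 0"
  using in_range[of x] by (simp add: stress24_def height_nonneg)

lemma diag_pos: "x \<in> {x_min..x_max} \<Longrightarrow> diag x > 0"
  using diagonals_pos(2)[OF hinge_configuration[of x, unfolded hinge_def]] by (simp only: hinge_dist)

text \<open>At the largest \<open>x\<close> one of the triangles is flat with its apex between \<open>p1\<close> and \<open>p3\<close>, so the
  quadrilateral is a triangle with an additional vertex on a side. Exactly one triangle is flat,
  since \<open>a + b \<noteq> c + d\<close>.\<close>

lemma stress13_x_max: "stress13 x_max > 0" and stress24_x_max: "stress24 x_max = 0"
proof -
  have x_max: "x_max > 0" using x_min_pos x_min_less_x_max by simp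
  have "stress13 x_max > 0 \<and> stress24 x_max = 0"
  proof (cases "a + b < c + d")
    case True
    then have e: "x_max = a + b" by (simp add: x_max_def)
    have u: "u x_max = a" "h x_max = 0" using pos by (simp_all add: e foot_at_sum height_def)
    have k: "k x_max > 0" using x_max True x_min_less_x_max e by (intro height_pos) (auto simp: x_min_def)
    show ?thesis using pos k u e by (simp add: stress13_def stress24_def area124_def area234_def)
  next
    case False
    then have lt: "c + d < a + b" using side_sums by simp
    then have e: "x_max = d + c" by (simp add: x_max_def)
    have v: "v x_max = d" "k x_max = 0" using pos by (simp_all add: e foot_at_sum height_def)
    have h: "h x_max > 0" using x_max lt x_min_less_x_max e by (intro height_pos) (auto simp: x_min_def)
    show ?thesis using pos h v e by (simp add: stress13_def stress24_def area124_def area234_def)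
  qed
  then show "stress13 x_max > 0" "stress24 x_max = 0" by auto
qed

text \<open>At the smallest \<open>x\<close> the apex of a flat triangle lies on the first axis outside the segment
  \<open>p1 p3\<close>, so the line \<open>p2 p4\<close> does not separate \<open>p1\<close> from \<open>p3\<close>.\<close>

lemma stress13_x_min: "stress13 x_min < 0"
proof (cases "\<bar>a - b\<bar> > \<bar>c - d\<bar>")
  case True
  then have e: "x_min = \<bar>a - b\<bar>" "x_min = \<bar>b - a\<bar>" and ne: "a \<noteq> b" by (auto simp: x_min_def)
  have u: "u x_min = a * sgn (a - b)" using foot_at_diff[OF ne] e by simp
  have u': "x_min - u x_min = b * sgn (b - a)"
    using foot_at_diff[of b a] ne e foot_complement[OF x_min_pos, of a b] by simp
  have h: "h x_min = 0" using ne by (simp add: height_def u power_mult_distrib sgn_if)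
  have k: "k x_min > 0" using x_min_pos True x_min_less_x_max e by (intro height_pos) (auto simp: x_max_def)
  have "area234 x_min = b * sgn (b - a) * k x_min" unfolding area234_def u' h by simp
  moreover have "area124 x_min = a * sgn (a - b) * k x_min" unfolding area124_def u h by simp
  ultimately have "stress13 x_min = - (a * b * (k x_min)\<^sup>2)"
    using ne by (auto simp: stress13_def sgn_if power2_eq_square)
  then show ?thesis using pos k by simp
next
  case False
  then have lt: "\<bar>c - d\<bar> > \<bar>a - b\<bar>" using side_sums by simp
  then have e: "x_min = \<bar>c - d\<bar>" "x_min = \<bar>d - c\<bar>" and ne: "d \<noteq> c" by (auto simp: x_min_def)
  have v: "v x_min = d * sgn (d - c)" using foot_at_diff[OF ne] e by simp
  have v': "x_min - v x_min = c * sgn (c - d)"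
    using foot_at_diff[of c d] ne e foot_complement[OF x_min_pos, of d c] by simp
  have k: "k x_min = 0" using ne by (simp add: height_def v power_mult_distrib sgn_if)
  have h: "h x_min > 0" using x_min_pos lt x_min_less_x_max e by (intro height_pos) (auto simp: x_max_def)
  have "area234 x_min = c * sgn (c - d) * h x_min" unfolding area234_def v' k by simp
  moreover have "area124 x_min = d * sgn (d - c) * h x_min" unfolding area124_def v k by simp
  ultimately have "stress13 x_min = - (c * d * (h x_min)\<^sup>2)"
    using ne by (auto simp: stress13_def sgn_if power2_eq_square)
  then show ?thesis using pos h by simp
qed

lemma flat_at_p1:
  assumes x: "x_min < x" "x < x_max" and flat: "area124 x = 0"
  shows "diag x = a + d" "x\<^sup>2 * (a + d) = a * c\<^sup>2 + d * b\<^sup>2 - d * a * (a + d)"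
proof -
  define p1 p2 p3 p4 where p: "p1 = (0::real^2)" "p2 = pt (u x) (- h x)" "p3 = pt x 0" "p4 = pt (v x) (k x)"
  have x': "x \<in> {x_min..x_max}" using x by simp
  have cf: "dist p1 p2 = a" "dist p2 p3 = b" "dist p3 p4 = c" "dist p4 p1 = d"
    using hinge_configuration[OF x'] by (simp_all add: p hinge_def configurations_def)
  have t: "tri p1 p2 p3 = x * h x" "tri p1 p3 p4 = x * k x" "tri p1 p2 p4 = 0" "tri p2 p3 p4 = area234 x"
    unfolding p hinge_tri flat by simp_all
  have t': "tri p4 p1 p2 = tri p1 p2 p4" "tri p4 p2 p3 = tri p2 p3 p4" "tri p4 p1 p3 = tri p1 p3 p4"
    by (simp_all add: tri_def algebra_simps)
  have "p1 \<in> closed_segment p4 p2"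
    using interior_heights[OF x] in_range(1)[OF x'] flat by (intro flat_vertex[of _ _ _ p3]) (auto simp: t t')
  note sg = this stewart[OF this, of p3]
  have "dist p4 p2 = a + d"
    using sg(1) cf by (simp add: between dist_commute flip: between_mem_segment)
  moreover have "dist p4 p2 = diag x" unfolding p using hinge_dist(2) by (simp add: dist_commute)
  moreover have "dist p1 p3 = x" unfolding p using hinge_dist(1) in_range(1)[OF x'] by simp
  ultimately show "diag x = a + d" "x\<^sup>2 * (a + d) = a * c\<^sup>2 + d * b\<^sup>2 - d * a * (a + d)"
    using sg(2) cf by (simp_all add: dist_commute)
qed

lemma flat_at_p3:
  assumes x: "x_min < x" "x < x_max" and flat: "area234 x = 0"
  shows "diag x = b + c" "x\<^sup>2 * (b + c) = c * a\<^sup>2 + b * d\<^sup>2 - b * c * (b + c)"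
proof -
  define p1 p2 p3 p4 where p: "p1 = (0::real^2)" "p2 = pt (u x) (- h x)" "p3 = pt x 0" "p4 = pt (v x) (k x)"
  have x': "x \<in> {x_min..x_max}" using x by simp
  have cf: "dist p1 p2 = a" "dist p2 p3 = b" "dist p3 p4 = c" "dist p4 p1 = d"
    using hinge_configuration[OF x'] by (simp_all add: p hinge_def configurations_def)
  have t: "tri p1 p2 p3 = x * h x" "tri p1 p3 p4 = x * k x" "tri p1 p2 p4 = area124 x" "tri p2 p3 p4 = 0"
    unfolding p hinge_tri flat by simp_all
  have t': "tri p2 p4 p1 = tri p1 p2 p4" "tri p3 p4 p1 = tri p1 p3 p4" "tri p2 p3 p1 = tri p1 p2 p3"
    by (simp_all add: tri_def algebra_simps)
  have "p3 \<in> closed_segment p2 p4"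
    using interior_heights[OF x] in_range(1)[OF x'] flat by (intro flat_vertex[of _ _ _ p1]) (auto simp: t t')
  note sg = this stewart[OF this, of p1]
  have "dist p2 p4 = b + c"
    using sg(1) cf by (simp add: between flip: between_mem_segment)
  moreover have "dist p2 p4 = diag x" unfolding p using hinge_dist(2) by simp
  moreover have "dist p3 p1 = x" unfolding p using hinge_dist(1) in_range(1)[OF x'] by (simp add: dist_commute)
  ultimately show "diag x = b + c" "x\<^sup>2 * (b + c) = c * a\<^sup>2 + b * d\<^sup>2 - b * c * (b + c)"
    using sg(2) cf by (simp_all add: dist_commute)
qed

text \<open>If the coefficient of \<open>x\<^sup>2\<close> vanishes, the stress inequality bounds the other diagonal, so two
  such values of \<open>x\<close> share it. A flat \<open>p1\<close> makes it \<open>a + d\<close> and a flat \<open>p3\<close> makes it \<open>b + c\<close>;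
  these differ, so the same vertex is flat both times, and Stewart's theorem gives the same \<open>x\<close>.\<close>

lemma unique_flat:
  assumes x: "x_min < x" "x < x_max" "stress13 x = 0" and y: "x_min < y" "y < x_max" "stress13 y = 0"
  shows "x = y"
proof -
  have le: "diag t \<le> diag s" if "x_min < s" "s < x_max" "stress13 s = 0" "x_min < t" "t < x_max" for s t
  proof -
    have "stress24 s * ((diag t)\<^sup>2 - (diag s)\<^sup>2) \<le> 0"
      using hinge_hinge_stress[of s t] that by simp
    then have "(diag t)\<^sup>2 \<le> (diag s)\<^sup>2" using interior_heights(3)[of s] that by (simp add: mult_le_0_iff)
    then show ?thesis using diag_pos[of s] that by (simp add: power2_le_iff_abs_le)
  qed
  have eq: "diag x = diag y" using le[of x y] le[of y x] assms by simp
  have sq: "s = t" if "s\<^sup>2 * w = r" "t\<^sup>2 * w = r" "w > 0" "s > 0" "t > 0" for s t w r :: real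
    using that by (metis mult_right_cancel less_irrefl power2_eq_imp_eq less_imp_le)
  have xy: "x > 0" "y > 0" using x y x_min_pos by auto
  consider "area124 x = 0" "area124 y = 0" | "area234 x = 0" "area234 y = 0"
    | "area124 x = 0" "area234 y = 0" | "area234 x = 0" "area124 y = 0"
    using assms by (auto simp: stress13_def)
  then show ?thesis
  proof cases
    case 1
    then show ?thesis using sq[OF flat_at_p1(2) flat_at_p1(2)] x y xy pos by simp
  next
    case 2
    then show ?thesis using sq[OF flat_at_p3(2) flat_at_p3(2)] x y xy pos by simp
  next
    case 3
    then show ?thesis using flat_at_p1(1)[of x] flat_at_p3(1)[of y] x y eq side_sums by simp
  next
    case 4
    then show ?thesis using flat_at_p3(1)[of x] flat_at_p1(1)[of y] x y eq side_sums by simp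
  qed
qed

lemma continuous_hinge_data:
  "continuous_on {x_min..x_max} u" "continuous_on {x_min..x_max} v" "continuous_on {x_min..x_max} h" "continuous_on {x_min..x_max} k"
  using in_range(1) by (auto intro!: continuous_on_foot continuous_on_height)

lemma continuous_stress13: "continuous_on {x_min..x_max} stress13"
  unfolding stress13_def area124_def area234_def by (intro continuous_intros continuous_hinge_data)

lemma continuous_stress24: "continuous_on {x_min..x_max} stress24"
  unfolding stress24_def by (intro continuous_intros continuous_hinge_data)

lemma continuous_diag: "continuous_on {x_min..x_max} diag"
  unfolding diag_def by (intro continuous_intros continuous_hinge_data)

lemma continuous_hinge: "continuous_on {x_min..x_max} hinge"
  unfolding hinge_def by (intro continuous_intros continuous_on_pt continuous_hinge_data)

section \<open>Convex configurations and their charges\<close>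

text \<open>A zero \<open>x0\<close> of \<open>stress13\<close> maximizes \<open>diag\<close> by the stress inequality at \<open>x0\<close>. The stress
  inequality at any other \<open>x\<close>, applied to the hinge at \<open>x0\<close>, then fixes the sign of
  \<open>stress13 x\<close>.\<close>

lemma convex_threshold:
  obtains x0 where "x_min < x0" "x0 < x_max" "stress13 x0 = 0"
    "\<And>x. x0 < x \<Longrightarrow> x \<le> x_max \<Longrightarrow> stress13 x > 0" "\<And>x. x_min \<le> x \<Longrightarrow> x < x0 \<Longrightarrow> stress13 x < 0"
proof -
  obtain x0 where x0: "x_min \<le> x0" "x0 \<le> x_max" "stress13 x0 = 0"
    using IVT'[of stress13 x_min 0 x_max] stress13_x_min stress13_x_max x_min_less_x_max continuous_stress13 by auto
  have "x0 \<noteq> x_min" "x0 \<noteq> x_max" using x0 stress13_x_min stress13_x_max by auto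
  then have int: "x_min < x0" "x0 < x_max" using x0 by auto
  have s0: "stress24 x0 > 0" using interior_heights int by blast
  have sgn: "stress13 x * (x0\<^sup>2 - x\<^sup>2) \<le> 0" if "x_min < x" "x < x_max" for x
  proof -
    have xi: "x \<in> {x_min..x_max}" "x0 \<in> {x_min..x_max}" using that int by auto
    have "stress24 x0 * ((diag x)\<^sup>2 - (diag x0)\<^sup>2) \<le> 0"
      using hinge_hinge_stress[OF xi(2,1)] x0(3) by simp
    then have "(diag x)\<^sup>2 \<le> (diag x0)\<^sup>2" using s0 by (simp add: mult_le_0_iff)
    then have "stress24 x * ((diag x0)\<^sup>2 - (diag x)\<^sup>2) \<ge> 0"
      using stress24_nonneg[OF xi(1)] by simp
    then show ?thesis using hinge_hinge_stress[OF xi] by linarith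
  qed
  show ?thesis
  proof (rule that[OF int x0(3)])
    fix x assume x: "x0 < x" "x \<le> x_max"
    show "stress13 x > 0"
    proof (cases "x = x_max")
      case False
      then have "stress13 x \<noteq> 0" using unique_flat[of x x0] x int x0(3) by auto
      moreover have "x0\<^sup>2 < x\<^sup>2" using x int x_min_pos by (intro power_strict_mono) auto
      ultimately show ?thesis using sgn[of x] x int False by (auto simp: mult_le_0_iff)
    qed (simp add: stress13_x_max)
  next
    fix x assume x: "x_min \<le> x" "x < x0"
    show "stress13 x < 0"
    proof (cases "x = x_min")
      case False
      then have "stress13 x \<noteq> 0" using unique_flat[of x x0] x int x0(3) by auto
      moreover have "x\<^sup>2 < x0\<^sup>2" using x int x_min_pos by (intro power_strict_mono) auto
      ultimately show ?thesis using sgn[of x] x int False by (auto simp: mult_le_0_iff)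
    qed (simp add: stress13_x_min)
  qed
qed

text \<open>The charge $t=(x^3\lambda_1\lambda_3)/(y^3\lambda_2\lambda_4)$ grows for three reasons: \<open>x\<close> grows, \<open>y\<close>
  decreases, and the steepness $\lambda_1\lambda_3/(\lambda_2\lambda_4)$ of the supporting line does not
  decrease.
  The inequality is stated without division because \<open>stress24\<close> vanishes at \<open>x_max\<close>.\<close>

lemma charge_increasing:
  assumes x: "x_min < x" "x < y" "y \<le> x_max" and s: "stress13 x \<ge> 0" "stress13 y > 0"
  shows "x^3 * stress13 x * ((diag y)^3 * stress24 y) < y^3 * stress13 y * ((diag x)^3 * stress24 x)"
proof -
  have xi: "x \<in> {x_min..x_max}" "y \<in> {x_min..x_max}" using x by auto
  have x0: "x > 0" "y > 0" using in_range(1) xi by auto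
  have dp: "diag x > 0" "diag y > 0" using diag_pos xi by auto
  have s2: "stress24 x > 0" using interior_heights(3)[of x] x by simp
  have s2y: "stress24 y \<ge> 0" using stress24_nonneg xi by simp
  have rhs: "y^3 * stress13 y * ((diag x)^3 * stress24 x) > 0" using x0 dp s s2 by simp
  show ?thesis
  proof (cases "stress13 x = 0 \<or> stress24 y = 0")
    case True
    then show ?thesis using rhs by auto
  next
    case False
    then have p: "stress13 x > 0" "stress24 y > 0" using s s2y by auto
    have sq: "y\<^sup>2 - x\<^sup>2 > 0" using x x0 by (simp add: power_strict_mono)
    note st = hinge_hinge_stress[OF xi] hinge_hinge_stress[OF xi(2,1)]
    have "stress24 x * ((diag y)\<^sup>2 - (diag x)\<^sup>2) < 0"
      using st(1) mult_pos_pos[OF p(1) sq] by linarith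
    then have "(diag y)\<^sup>2 < (diag x)\<^sup>2" using s2 by (simp add: mult_less_0_iff)
    then have d: "diag y < diag x" using dp by (simp add: power2_less_imp_less)
    (* Eliminating the second diagonal from the stress inequalities at x and at y. *)
    have "(stress13 x * stress24 y - stress13 y * stress24 x) * (y\<^sup>2 - x\<^sup>2)
        = stress24 y * (stress13 x * (y\<^sup>2 - x\<^sup>2) + stress24 x * ((diag y)\<^sup>2 - (diag x)\<^sup>2))
        + stress24 x * (stress13 y * (x\<^sup>2 - y\<^sup>2) + stress24 y * ((diag x)\<^sup>2 - (diag y)\<^sup>2))"
      by algebra
    also have "\<dots> \<le> 0" using st s2 p(2) by (simp add: add_nonpos_nonpos mult_nonneg_nonpos)
    finally have G: "stress13 x * stress24 y \<le> stress13 y * stress24 x" using sq by (simp add: mult_le_0_iff)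
    have "x^3 * (diag y)^3 < y^3 * (diag x)^3"
      using x x0 d dp by (intro mult_strict_mono power_strict_mono) auto
    then have "(x^3 * (diag y)^3) * (stress13 x * stress24 y) < (y^3 * (diag x)^3) * (stress13 x * stress24 y)"
      using p by (intro mult_strict_right_mono) auto
    also have "\<dots> \<le> (y^3 * (diag x)^3) * (stress13 y * stress24 x)"
      using G x0 dp by (intro mult_left_mono) auto
    finally show ?thesis by (simp add: ac_simps)
  qed
qed

text \<open>A configuration with the same energy has the same two diagonals. Then also the product of areas of
  lemma \<open>tri_product_dist\<close> is the same and positive, so it is an opposite-sided configuration with
  the same \<open>x\<close>, hence congruent to the hinge.\<close>

lemma hinge_minimizes:
  assumes x: "x_min < x" "x < x_max" "stress13 x > 0" and t: "t > 0"
    and crit: "x^3 * stress13 x = t * ((diag x)^3 * stress24 x)"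
    and q: "q \<in> configurations a b c d"
  shows "quad_potential t (hinge x) \<le> quad_potential t q"
    and "quad_potential t q \<le> quad_potential t (hinge x) \<Longrightarrow> (q, hinge x) \<in> congruence"
proof -
  obtain q1 q2 q3 q4 where qq: "q = (q1, q2, q3, q4)" by (cases q)
  have xi: "x \<in> {x_min..x_max}" using x by simp
  have x0: "x > 0" using in_range(1)[OF xi] .
  have s2: "stress24 x > 0" using interior_heights x by blast
  have y0: "diag x > 0" using diag_pos xi by simp
  let ?g = "stress13 x / stress24 x"
  have "stress24 x * (?g * ((dist q1 q3)\<^sup>2 - x\<^sup>2) + ((dist q2 q4)\<^sup>2 - (diag x)\<^sup>2)) \<le> 0"
    using hinge_stress[OF xi q[unfolded qq]] s2 by (simp add: distrib_left)
  then have supp: "?g * ((dist q1 q3)\<^sup>2 - x\<^sup>2) + ((dist q2 q4)\<^sup>2 - (diag x)\<^sup>2) \<le> 0"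
    using s2 by (simp only: mult_le_0_iff) linarith
  have tt: "t = ?g * x^3 / (diag x)^3" using crit s2 y0 by (simp add: field_simps)
  note min = supporting_line_minimizes[OF x0 y0 diagonals_pos[OF q[unfolded qq]] t supp tt]
  have pot: "quad_potential t (hinge x) = t / x + 1 / diag x"
    unfolding hinge_def quad_potential.simps hinge_dist using x0 by simp
  show "quad_potential t (hinge x) \<le> quad_potential t q"
    unfolding pot unfolding qq using min(1) by simp
  assume "quad_potential t q \<le> quad_potential t (hinge x)"
  then have d: "dist q1 q3 = x" "dist q2 q4 = diag x" using min(2) unfolding pot unfolding qq by auto
  have "tri q1 q2 q3 * tri q1 q3 q4 = stress24 x"
    using tri_product_dist[of q1 q2 0 "pt (u x) (- h x)" q3 "pt x 0" q4 "pt (v x) (k x)"]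
      hinge_configuration[OF xi] q d x0
    by (simp add: hinge_def configurations_def qq hinge_tri hinge_dist stress24_def del: dist_0_norm)
  then show "(q, hinge x) \<in> congruence"
    using congruent_hinge[OF q[unfolded qq]] s2 d qq by simp
qed

lemma class_hinge_inj: "inj_on (\<lambda>x. congruence `` {hinge x}) {x_min..x_max}"
proof (rule inj_onI)
  fix x y assume xy: "x \<in> {x_min..x_max}" "y \<in> {x_min..x_max}" "congruence `` {hinge x} = congruence `` {hinge y}"
  have "(hinge x, hinge y) \<in> congruence" using eq_equiv_class[OF xy(3) equiv_congruence] by simp
  then have "dist (0::real^2) (pt x 0) = dist (0::real^2) (pt y 0)"
    unfolding hinge_def by (rule congruence_dist(5))
  then show "x = y" using in_range(1) xy by (simp only: hinge_dist) fastforce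
qed

text \<open>The two products of areas that decide convexity are congruence invariants, so they can be computed on
  the congruent hinge.\<close>

lemma convex_configuration_class:
  assumes p: "p \<in> configurations a b c d" and cv: "convex_quad p"
  obtains x where "x \<in> {x_min..x_max}" "stress13 x \<ge> 0" "congruence `` {p} = congruence `` {hinge x}"
    "strictly_convex_quad p \<Longrightarrow> stress13 x > 0 \<and> stress24 x > 0"
proof -
  obtain p1 p2 p3 p4 where pp: "p = (p1, p2, p3, p4)" by (cases p)
  let ?x = "dist p1 p3"
  have x: "?x \<in> {x_min..x_max}" using configuration_range p pp by simp
  note gen = configuration_generic[OF p[unfolded pp]]
  have nn: "tri p1 p2 p3 * tri p1 p3 p4 \<ge> 0" "tri p2 p3 p4 * tri p1 p2 p4 \<ge> 0"
    using cv convex_quad_iff_tri[OF gen] unfolding pp by auto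
  have cong: "(p, hinge ?x) \<in> congruence" using congruent_hinge[OF p[unfolded pp] nn(1)] pp by simp
  note ds = congruence_dist[OF cong[unfolded pp hinge_def]]
  have e2: "tri p1 p2 p3 * tri p1 p3 p4 = stress24 ?x"
    using tri_product_dist[OF ds] by (simp only: hinge_tri stress24_def)
  have "dist p3 p1 = dist (pt ?x 0) 0" using ds(5) by (simp only: dist_commute)
  from tri_product_dist[OF ds(2,3,4,1,6) this]
  have e1: "tri p2 p3 p4 * tri p1 p2 p4 = stress13 ?x"
    by (simp only: tri_rotate[of p2 p4 p1] tri_rotate[of _ _ 0] hinge_tri stress13_def)
  show ?thesis
  proof (rule that[OF x])
    show "stress13 ?x \<ge> 0" using nn(2) e1 by simp
    show "congruence `` {p} = congruence `` {hinge ?x}"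
      using equiv_class_eq[OF equiv_congruence cong] .
    show "stress13 ?x > 0 \<and> stress24 ?x > 0" if "strictly_convex_quad p"
      using that strictly_convex_quad_iff_tri[OF gen] e1 e2 unfolding pp by simp
  qed
qed

lemma convex_moduli_eq:
  assumes x0: "x_min < x0" "x0 < x_max" "stress13 x0 = 0"
    "\<And>x. x0 < x \<Longrightarrow> x \<le> x_max \<Longrightarrow> stress13 x > 0" "\<And>x. x_min \<le> x \<Longrightarrow> x < x0 \<Longrightarrow> stress13 x < 0"
  shows "convex_moduli a b c d = (\<lambda>x. congruence `` {hinge x}) ` {x0..x_max}"
    and "strictly_convex_moduli a b c d = (\<lambda>x. congruence `` {hinge x}) ` {x0<..<x_max}"
proof -
  have s1: "stress13 x \<ge> 0 \<longleftrightarrow> x0 \<le> x" "stress13 x > 0 \<longleftrightarrow> x0 < x" if "x \<in> {x_min..x_max}" for x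
    using x0(3) x0(4)[of x] x0(5)[of x] that by (cases x x0 rule: linorder_cases; force)+
  have s2: "stress24 x > 0 \<longleftrightarrow> x < x_max" if "x \<in> {x0..x_max}" for x
    using interior_heights(3)[of x] stress24_x_max x0 that by (cases "x = x_max") auto
  show "convex_moduli a b c d = (\<lambda>x. congruence `` {hinge x}) ` {x0..x_max}"
  proof (intro equalityI subsetI)
    fix C assume "C \<in> convex_moduli a b c d"
    then obtain p where p: "p \<in> configurations a b c d" "convex_quad p" "C = congruence `` {p}"
      by (auto simp: convex_moduli_def quotient_def)
    obtain x where "x \<in> {x_min..x_max}" "stress13 x \<ge> 0" "C = congruence `` {hinge x}"
      using convex_configuration_class[OF p(1,2)] p(3) by metis
    then show "C \<in> (\<lambda>x. congruence `` {hinge x}) ` {x0..x_max}" using s1(1)[of x] by auto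
  next
    fix C assume "C \<in> (\<lambda>x. congruence `` {hinge x}) ` {x0..x_max}"
    then obtain x where x: "x \<in> {x0..x_max}" "C = congruence `` {hinge x}" by auto
    then have xi: "x \<in> {x_min..x_max}" using x0 by auto
    then have "convex_quad (hinge x)" using hinge_convex_iff(1) stress24_nonneg s1(1) x(1) by auto
    then show "C \<in> convex_moduli a b c d"
      using hinge_configuration[OF xi] x(2) by (auto simp: convex_moduli_def intro!: quotientI)
  qed
  show "strictly_convex_moduli a b c d = (\<lambda>x. congruence `` {hinge x}) ` {x0<..<x_max}"
  proof (intro equalityI subsetI)
    fix C assume "C \<in> strictly_convex_moduli a b c d"
    then obtain p where p: "p \<in> configurations a b c d" "strictly_convex_quad p" "C = congruence `` {p}"
      by (auto simp: strictly_convex_moduli_def quotient_def)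
    have "convex_quad p" using p(2) by (cases p) simp
    then obtain x where x: "x \<in> {x_min..x_max}" "stress13 x > 0" "stress24 x > 0" "C = congruence `` {hinge x}"
      using convex_configuration_class[OF p(1)] p(2,3) by metis
    then have "x \<in> {x0<..<x_max}" using s1(2)[of x] s2[of x] by auto
    then show "C \<in> (\<lambda>x. congruence `` {hinge x}) ` {x0<..<x_max}" using x(4) by blast
  next
    fix C assume "C \<in> (\<lambda>x. congruence `` {hinge x}) ` {x0<..<x_max}"
    then obtain x where x: "x \<in> {x0<..<x_max}" "C = congruence `` {hinge x}" by auto
    then have xi: "x \<in> {x_min..x_max}" using x0 by auto
    then have "strictly_convex_quad (hinge x)" using hinge_convex_iff(2) s2[of x] s1(2) x(1) by auto
    then show "C \<in> strictly_convex_moduli a b c d"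
      using hinge_configuration[OF xi] x(2) by (auto simp: strictly_convex_moduli_def intro!: quotientI)
  qed
qed

lemma minimum_class:
  assumes x: "x_min < x" "x < x_max" "stress13 x > 0" and t: "t > 0"
    and crit: "x^3 * stress13 x = t * ((diag x)^3 * stress24 x)"
  shows "{C \<in> moduli_space a b c d. \<forall>C' \<in> moduli_space a b c d. coulomb t C \<le> coulomb t C'}
    = {congruence `` {hinge x}}"
proof -
  note min = hinge_minimizes[OF x t crit]
  have hx: "hinge x \<in> configurations a b c d" using hinge_configuration x by simp
  then have cl: "congruence `` {hinge x} \<in> moduli_space a b c d"
    by (auto simp: moduli_space_def intro!: quotientI)
  show ?thesis
  proof (intro equalityI subsetI)
    fix C assume "C \<in> {C \<in> moduli_space a b c d. \<forall>C' \<in> moduli_space a b c d. coulomb t C \<le> coulomb t C'}"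
    then obtain q where q: "q \<in> configurations a b c d" "C = congruence `` {q}"
      and le: "coulomb t C \<le> coulomb t (congruence `` {hinge x})"
      using cl by (auto simp: moduli_space_def quotient_def)
    have "(q, hinge x) \<in> congruence" using min(2)[OF q(1)] le by (simp add: q(2) coulomb_class)
    then show "C \<in> {congruence `` {hinge x}}" using equiv_class_eq[OF equiv_congruence] q(2) by simp
  next
    fix C assume "C \<in> {congruence `` {hinge x}}"
    moreover have "coulomb t (congruence `` {hinge x}) \<le> coulomb t C'" if "C' \<in> moduli_space a b c d" for C'
      using that min(1) by (auto simp: moduli_space_def quotient_def coulomb_class)
    ultimately show "C \<in> {C \<in> moduli_space a b c d. \<forall>C' \<in> moduli_space a b c d. coulomb t C \<le> coulomb t C'}"
      using cl by auto
  qed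
qed

lemma continuous_map_class_hinge:
  assumes "continuous_on UNIV X" "range X \<subseteq> {x_min..x_max}"
  shows "continuous_map euclidean (moduli_topology a b c d) (\<lambda>t. congruence `` {hinge (X t)})"
proof -
  have "continuous_on UNIV (\<lambda>t. hinge (X t))"
    by (rule continuous_on_compose2[OF continuous_hinge assms])
  then have "continuous_map euclidean (top_of_set (configurations a b c d)) (\<lambda>t. hinge (X t))"
    using assms(2) hinge_configuration by (auto simp: continuous_map_in_subtopology)
  moreover have "continuous_map (top_of_set (configurations a b c d)) (moduli_topology a b c d)
      (\<lambda>p. congruence `` {p})"
    unfolding moduli_topology_def by (rule quotient_imp_continuous_map[OF quotient_map_quotient_topology])
  ultimately show ?thesis using continuous_map_compose by (fastforce simp: o_def)
qed

end

theorem theorem1: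
  fixes a b c d :: real
  assumes "a > 0" and "b > 0" and "c > 0" and "d > 0"
    and "moduli_space a b c d \<noteq> {}"
    and "nondegenerate a b c d"
  shows "\<exists>\<phi> :: real \<Rightarrow> quad set.
      continuous_map (top_of_set {0<..})
        (subtopology (moduli_topology a b c d) (strictly_convex_moduli a b c d)) \<phi> \<and>
      bij_betw \<phi> {0<..} (strictly_convex_moduli a b c d) \<and>
      (\<forall>t>0. {C \<in> moduli_space a b c d.
                \<forall>C' \<in> moduli_space a b c d. coulomb t C \<le> coulomb t C'} = {\<phi> t}) \<and>
      (\<exists>\<psi> :: ennreal \<Rightarrow> quad set.
        (\<forall>t>0. \<psi> (ennreal t) = \<phi> t) \<and>
        continuous_map euclidean
          (subtopology (moduli_topology a b c d) (convex_moduli a b c d)) \<psi> \<and>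
        bij_betw \<psi> UNIV (convex_moduli a b c d))"
proof -
  interpret four_bar a b c d using assms by unfold_locales
  obtain x0 where x0: "x_min < x0" "x0 < x_max" "stress13 x0 = 0"
    "\<And>x. x0 < x \<Longrightarrow> x \<le> x_max \<Longrightarrow> stress13 x > 0" "\<And>x. x_min \<le> x \<Longrightarrow> x < x0 \<Longrightarrow> stress13 x < 0"
    using convex_threshold by blast
  have sub: "{x0..x_max} \<subseteq> {x_min..x_max}" using x0 by auto
  (* N x / D x is the charge whose energy is minimal at the hinge with diagonal x. *)
  define N where "N x = x^3 * stress13 x" for x
  define D where "D x = (diag x)^3 * stress24 x" for x
  obtain X :: "ennreal \<Rightarrow> real" where X: "continuous_on UNIV X" "bij_betw X UNIV {x0..x_max}"
    "\<And>t. t > 0 \<Longrightarrow> X (ennreal t) \<in> {x0<..<x_max} \<and> N (X (ennreal t)) = t * D (X (ennreal t))"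
    "\<And>x. x \<in> {x0<..<x_max} \<Longrightarrow> \<exists>t>0. X (ennreal t) = x"
  proof (rule ennreal_reparametrization[OF x0(2), of N D])
    show "continuous_on {x0..x_max} N" "continuous_on {x0..x_max} D"
      unfolding N_def D_def
      by (intro continuous_intros continuous_on_subset[OF continuous_stress13 sub]
          continuous_on_subset[OF continuous_stress24 sub] continuous_on_subset[OF continuous_diag sub])+
    show "N x0 = 0" "D x_max = 0" by (simp_all add: N_def D_def x0(3) stress24_x_max)
    show "N x > 0" if "x0 < x" "x \<le> x_max" for x
      using that x0(4)[OF that] x0(1) x_min_pos by (simp add: N_def)
    show "D x > 0" if "x0 \<le> x" "x < x_max" for x
      using that x0(1) interior_heights(3)[of x] diag_pos[of x] by (simp add: D_def)
    show "N x * D y < N y * D x" if "x0 \<le> x" "x < y" "y \<le> x_max" for x y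
      unfolding N_def D_def
    proof (rule charge_increasing)
      show "stress13 x \<ge> 0" using that x0(3) x0(4)[of x] by (cases "x = x0") auto
    qed (use that x0 in auto)
  qed blast
  have ran: "range X = {x0..x_max}" using X(2) by (simp add: bij_betw_def)
  define \<psi> where "\<psi> t = congruence `` {hinge (X t)}" for t
  define \<phi> where "\<phi> t = \<psi> (ennreal t)" for t
  have inj: "inj_on (\<lambda>x. congruence `` {hinge x}) {x0..x_max}" by (rule inj_on_subset[OF class_hinge_inj sub])
  have moduli: "convex_moduli a b c d = (\<lambda>x. congruence `` {hinge x}) ` {x0..x_max}"
    "strictly_convex_moduli a b c d = (\<lambda>x. congruence `` {hinge x}) ` {x0<..<x_max}"
    using x0 by (intro convex_moduli_eq; blast)+
  have cpsi: "continuous_map euclidean (moduli_topology a b c d) \<psi>"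
    unfolding \<psi>_def using X(1) ran sub by (intro continuous_map_class_hinge) auto
  have bpsi: "bij_betw \<psi> UNIV (convex_moduli a b c d)"
    using bij_betw_trans[OF X(2) inj_on_imp_bij_betw[OF inj]]
    unfolding moduli by (simp add: \<psi>_def[abs_def] o_def)
  have "bij_betw (\<lambda>t. X (ennreal t)) {0<..} {x0<..<x_max}"
  proof (rule bij_betwI')
    show "X (ennreal s) = X (ennreal t) \<longleftrightarrow> s = t" if "s \<in> {0<..}" "t \<in> {0<..}" for s t
      using that bij_betw_imp_inj_on[OF X(2)] by (simp add: inj_eq)
    show "X (ennreal t) \<in> {x0<..<x_max}" if "t \<in> {0<..}" for t using X(3)[of t] that by simp
    show "\<exists>t\<in>{0<..}. x = X (ennreal t)" if "x \<in> {x0<..<x_max}" for x using X(4)[OF that] by auto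
  qed
  then have bphi: "bij_betw \<phi> {0<..} (strictly_convex_moduli a b c d)"
    using bij_betw_trans[OF _ inj_on_imp_bij_betw[OF inj_on_subset[OF inj, of "{x0<..<x_max}"]]]
    unfolding moduli by (fastforce simp: \<phi>_def[abs_def] \<psi>_def o_def)
  have cphi: "continuous_map (top_of_set {0<..}) (moduli_topology a b c d) \<phi>"
  proof -
    have "continuous_map (top_of_set {0<..}) euclidean ennreal"
      by (auto intro: continuous_on_ennreal continuous_on_id)
    from continuous_map_compose[OF this cpsi] show ?thesis by (simp add: \<phi>_def[abs_def] o_def)
  qed
  have mini: "{C \<in> moduli_space a b c d. \<forall>C' \<in> moduli_space a b c d. coulomb t C \<le> coulomb t C'} = {\<phi> t}"
    if "t > 0" for t
    unfolding \<phi>_def \<psi>_def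
    using X(3)[OF that] x0 that by (intro minimum_class) (auto simp: N_def D_def)
  show ?thesis
  proof (intro exI[of _ \<phi>] exI[of _ \<psi>] conjI allI impI)
    show "continuous_map (top_of_set {0<..})
        (subtopology (moduli_topology a b c d) (strictly_convex_moduli a b c d)) \<phi>"
      using cphi bij_betw_imp_surj_on[OF bphi] by (auto simp: continuous_map_in_subtopology)
    show "continuous_map euclidean (subtopology (moduli_topology a b c d) (convex_moduli a b c d)) \<psi>"
      using cpsi bij_betw_imp_surj_on[OF bpsi] by (auto simp: continuous_map_in_subtopology)
    show "\<psi> (ennreal t) = \<phi> t" for t by (simp add: \<phi>_def)
  qed (use bphi bpsi mini in auto)
qed

end
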